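(* Let $\mathbf{G}_N$ be the $N\times N$ complex Ginibre matrix, let $\sigma\in(0,1)$ and an integer $k\ge 0$ be fixed, and for each $N$ let $\mathbf{b}_N\in\mathbb{C}^N$ be a nonzero (possibly random) vector independent of $\mathbf{G}_N$. Then the step $k$ GMRES residual norm $\|\mathbf{r}_N^{(k)}\|$ for the linear system $(\mathbf{I}+\sigma\mathbf{G}_N)\mathbf{x}=\mathbf{b}_N$ satisfies $$\frac{\|\mathbf{r}_N^{(k)}\|}{\|\mathbf{b}_N\|}\longrightarrow\left(\frac{1-\sigma^2}{1-\sigma^{2+2k}}\right)^{1/2}\sigma^k\qquad\text{in probability as } N\to\infty .$$
   Context: Ginibre matrix: $\mathbf{G}_N=\frac{1}{\sqrt{2N}}(\mathbf{X}_N+\mathrm{i}\,\mathbf{Y}_N)$, where $\mathbf{X}_N,\mathbf{Y}_N$ are independent $N\times N$ matrices with i.i.d. real standard Gaussian entries. All $N$ are treated on one probability space: $\mathbf{X}_N$ and $\mathbf{Y}_N$ are the leading $N\times N$ principal blocks of fixed infinite arrays of i.i.d. standard Gaussians. GMRES residual norm: for $\mathbf{A}\in\mathbb{C}^{N\times N}$ and $\mathbf{b}\in\mathbb{C}^N$, the step $k$ GMRES residual norm for $\mathbf{A}\mathbf{x}=\mathbf{b}$ is $$\|\mathbf{r}^{(k)}\|=\min_{\deg(p)\le k,\ p(0)=1}\|p(\mathbf{A})\mathbf{b}\|,$$ where the minimum is over complex polynomials $p$ and $\|\cdot\|$ is the Euclidean norm. *)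

theory Defs
  imports "HOL-Probability.Probability" "Jordan_Normal_Form.Matrix"
begin

(* HOL-Analysis and Jordan_Normal_Form both provide vec, mat and the index notation $.
   Dimensions vary with N here, so the carrier-based types of Jordan_Normal_Form.Matrix
   are used throughout. *)
hide_type (open) Finite_Cartesian_Product.vec
hide_const (open) Finite_Cartesian_Product.vec Finite_Cartesian_Product.mat
unbundle no vec_syntax

definition vec_norm2 :: "complex vec \<Rightarrow> real" where
  "vec_norm2 v = L2_set (\<lambda>i. cmod (v $ i)) {..<dim_vec v}"

(* p(A) for a square matrix A; the entrywise sum is the matrix sum of the coeff p m * A^m *)
definition poly_mat :: "complex poly \<Rightarrow> complex mat \<Rightarrow> complex mat" where
  "poly_mat p A = mat (dim_row A) (dim_row A)
     (\<lambda>ij. \<Sum>m\<le>degree p. coeff p m * (A ^\<^sub>m m) $$ ij)"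

(* LEAST is the minimum over an infinite set; Min is meant for finite sets.  The minimum is
   attained, since it is the distance from b to a subspace of a finite-dimensional space. *)
definition gmres_residual_norm :: "nat \<Rightarrow> complex mat \<Rightarrow> complex vec \<Rightarrow> real" where
  "gmres_residual_norm k A b =
     (LEAST r. r \<in> {vec_norm2 (poly_mat p A *\<^sub>v b) | p. degree p \<le> k \<and> poly p 0 = 1})"

definition ginibre ::
  "(nat \<Rightarrow> nat \<Rightarrow> 'a \<Rightarrow> real) \<Rightarrow> (nat \<Rightarrow> nat \<Rightarrow> 'a \<Rightarrow> real) \<Rightarrow> nat \<Rightarrow> 'a \<Rightarrow> complex mat" where
  "ginibre X Y N \<omega> = complex_of_real (1 / sqrt (2 * real N)) \<cdot>\<^sub>m
     (mat N N (\<lambda>(i, j). complex_of_real (X i j \<omega>)) +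
      \<i> \<cdot>\<^sub>m mat N N (\<lambda>(i, j). complex_of_real (Y i j \<omega>)))"

(* The Borel sigma-algebras of C^N and C^(N x N), transported along the entries.  A measurable
   map into borel_vec N takes values in carrier_vec N. *)
definition borel_vec :: "nat \<Rightarrow> complex vec measure" where
  "borel_vec N = vimage_algebra (carrier_vec N) (\<lambda>v. \<lambda>i\<in>{..<N}. v $ i)
     (Pi\<^sub>M {..<N} (\<lambda>_. borel))"

definition borel_mat :: "nat \<Rightarrow> complex mat measure" where
  "borel_mat N = vimage_algebra (carrier_mat N N) (\<lambda>A. \<lambda>ij\<in>{..<N} \<times> {..<N}. A $$ ij)
     (Pi\<^sub>M ({..<N} \<times> {..<N}) (\<lambda>_. borel))"

(* indep_var requires both variables to have the same range type; this is the
   same notion without that restriction. *)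
definition (in prob_space) indep_rvs ::
  "'b measure \<Rightarrow> ('a \<Rightarrow> 'b) \<Rightarrow> 'c measure \<Rightarrow> ('a \<Rightarrow> 'c) \<Rightarrow> bool" where
  "indep_rvs S U T V \<longleftrightarrow> random_variable S U \<and> random_variable T V \<and>
     indep_set (sets (vimage_algebra (space M) U S)) (sets (vimage_algebra (space M) V T))"

(* Measurability is required explicitly because measure M is 0 on non-measurable sets. *)
definition (in prob_space) tendsto_in_prob :: "(nat \<Rightarrow> 'a \<Rightarrow> real) \<Rightarrow> real \<Rightarrow> bool" where
  "tendsto_in_prob Z c \<longleftrightarrow> (\<forall>N. random_variable borel (Z N)) \<and>
     (\<forall>\<epsilon>>0. (\<lambda>N. prob {\<omega> \<in> space M. \<bar>Z N \<omega> - c\<bar> > \<epsilon>}) \<longlonglongrightarrow> 0)"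

end

theory Submission
  imports Defs "HOL-Combinatorics.Multiset_Permutations"
begin

text \<open>Put \<open>f = b / \<parallel>b\<parallel>\<close>. The theorem reduces to the statement that the Krylov Gram matrix
  \<open>\<langle>G\<^sup>i f, G\<^sup>j f\<rangle>\<close>, \<open>i, j \<le> k\<close>, converges to the identity in probability: writing a residual polynomial
  as \<open>p(1 + \<sigma>z) = \<Sum>\<^sub>m c\<^sub>m z\<^sup>m\<close>, the squared residual is then nearly \<open>\<Sum>\<^sub>m |c\<^sub>m|\<^sup>2\<close>, and by Cauchy-Schwarz
  the minimum of this under \<open>\<Sum>\<^sub>m c\<^sub>m (-1/\<sigma>)\<^sup>m = 1\<close> is \<open>1 / \<Sum>\<^sub>m \<sigma>\<^sup>-\<^sup>2\<^sup>m\<close>.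

  The convergence holds in \<open>L\<^sup>2\<close> with rate \<open>O(1/N)\<close>. Expanding \<open>|\<langle>G\<^sup>i f, G\<^sup>j f\<rangle>|\<^sup>2\<close> into four walks \<open>P, Q, P', Q'\<close>
  on the coordinates, with \<open>P, Q\<close> and \<open>P', Q'\<close> sharing their starting points, the expectation over the
  circularly symmetric entries vanishes unless \<open>P, Q'\<close> together use the same directed edges as \<open>Q, P'\<close>. Then
  the end points agree as well, so the weight is \<open>|f(P\<^sub>i)|\<^sup>2 |f(Q'\<^sub>j)|\<^sup>2\<close>. If \<open>P, Q'\<close>
  visit every non-final vertex only once, the walks are forced to be \<open>Q = P\<close> and \<open>P' = Q'\<close>, which needs \<open>i = j\<close>;
  all other pairs \<open>P, Q'\<close> lose a factor \<open>N\<close>.\<close>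

section \<open>Moments of complex Gaussians\<close>

text \<open>Only one-sided bounds enter the second moment. For a Gram entry F and the Kronecker
  delta d, E |F - d|^2 = E |F|^2 - 2 d Re E F + d, so it is enough that E |F|^2 exceeds d by at most
  O(1/N) and that Re E F is at least 1 on the diagonal. The latter is positivity: every surviving
  term of the expansion has nonnegative real part.

  The randomness of \<open>b\<close> shapes the rest. Independence splits each expanded term into a
  monomial in the matrix entries and one in the coordinates of \<open>f\<close>. Once the matrix
  part is evaluated, the \<open>f\<close> part is collected under a single expectation, where a
  bound valid for each fixed vector of the unit ball applies. Rotating \<open>b\<close> to a
  coordinate vector is thereby avoided.

  Convergence in probability also asks for measurability of a minimum over uncountably many
  polynomials. This is why the residual norm is rewritten as an explicit recursion of
  projections.\<close>

definition std_normal_moment :: "nat \<Rightarrow> real" where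
  "std_normal_moment n = (\<integral>x. std_normal_density x * x ^ n \<partial>lborel)"

lemma std_normal_moment_0: "std_normal_moment 0 = 1"
  using integral_std_normal_moment_even[of 0] by (simp add: std_normal_moment_def)

lemma std_normal_moment_Suc:
  "std_normal_moment (Suc n) = real n * std_normal_moment (n - 1)"
proof (cases "even n")
  case True
  then obtain m where n: "n = 2 * m" by (elim evenE)
  have "std_normal_moment (Suc n) = 0"
    using integral_std_normal_moment_odd[of m] by (simp add: std_normal_moment_def n)
  moreover have "real n * std_normal_moment (n - 1) = 0"
  proof (cases m)
    case (Suc l)
    then show ?thesis
      using integral_std_normal_moment_odd[of l] by (simp add: std_normal_moment_def n)
  qed (simp add: n)
  ultimately show ?thesis by simp
next
  case False
  then obtain m where n: "n = 2 * m + 1" by (elim oddE)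
  have "std_normal_moment (Suc n) = fact (2 * Suc m) / (2 ^ Suc m * fact (Suc m))"
    using integral_std_normal_moment_even[of "Suc m"] by (simp add: std_normal_moment_def n)
  also have "\<dots> = real n * (fact (2 * m) / (2 ^ m * fact m))"
    by (simp add: n divide_simps)
  also have "fact (2 * m) / (2 ^ m * fact m) = std_normal_moment (n - 1)"
    using integral_std_normal_moment_even[of m] by (simp add: std_normal_moment_def n)
  finally show ?thesis .
qed

text \<open>Here \<open>I p q a b\<close> stands for \<open>\<E> (X\<^sup>p Y\<^sup>q Z\<^sup>a cnj Z\<^sup>b)\<close> with \<open>Z = X + \<i> Y\<close>; the conclusions
  are Gaussian integration by parts in \<open>X\<close> and in \<open>Y\<close>.\<close>

lemma complex_gaussian_by_parts:
  fixes I :: "nat \<Rightarrow> nat \<Rightarrow> nat \<Rightarrow> nat \<Rightarrow> complex"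
  assumes I0: "\<And>p q. I p q 0 0 = of_real (std_normal_moment p * std_normal_moment q)"
    and Ia: "\<And>p q a b. I p q (Suc a) b = I (Suc p) q a b + \<i> * I p (Suc q) a b"
    and Ib: "\<And>p q a b. I p q a (Suc b) = I (Suc p) q a b - \<i> * I p (Suc q) a b"
  shows "I (Suc p) q a b = of_nat p * I (p - 1) q a b + of_nat a * I p q (a - 1) b + of_nat b * I p q a (b - 1)
       \<and> I p (Suc q) a b = of_nat q * I p (q - 1) a b + \<i> * of_nat a * I p q (a - 1) b - \<i> * of_nat b * I p q a (b - 1)"
\<comment> \<open>\<open>Ia\<close> and \<open>Ib\<close> trade a factor \<open>Z\<close> or
  \<open>cnj Z\<close> for one more \<open>X\<close> or \<open>Y\<close>, so both identities are
  proved together and for all \<open>p\<close>, \<open>q\<close>. At \<open>a = b = 0\<close> they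
  are the recursion of the real normal moments. The truncation of \<open>p - 1\<close> at
  \<open>p = 0\<close> is harmless, as its coefficient is zero.\<close>
proof (induction a arbitrary: b p q)
  case 0
  show ?case
  proof (induction b arbitrary: p q)
    case 0
    show ?case by (simp add: I0 std_normal_moment_Suc)
  next
    case (Suc b)
    note IH = Suc.IH
    show ?case
    proof
      have "I (Suc p) q 0 (Suc b) = I (Suc (Suc p)) q 0 b - \<i> * I (Suc p) (Suc q) 0 b" by (rule Ib)
      also have "I (Suc (Suc p)) q 0 b = of_nat (Suc p) * I p q 0 b + of_nat b * I (Suc p) q 0 (b - 1)"
        using IH[of "Suc p" q] by simp
      also have "I (Suc p) (Suc q) 0 b = of_nat p * I (p - 1) (Suc q) 0 b + of_nat b * I p (Suc q) 0 (b - 1)"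
        using IH[of p "Suc q"] by simp
      finally show "I (Suc p) q 0 (Suc b) = of_nat p * I (p - 1) q 0 (Suc b) + of_nat 0 * I p q (0 - 1) (Suc b) 
          + of_nat (Suc b) * I p q 0 (Suc b - 1)"
        by (cases p; cases b) (simp_all add: Ib algebra_simps)
      have "I p (Suc q) 0 (Suc b) = I (Suc p) (Suc q) 0 b - \<i> * I p (Suc (Suc q)) 0 b" by (rule Ib)
      also have "I (Suc p) (Suc q) 0 b = of_nat q * I (Suc p) (q - 1) 0 b - \<i> * of_nat b * I (Suc p) q 0 (b - 1)"
        using IH[of "Suc p" q] by simp
      also have "I p (Suc (Suc q)) 0 b = of_nat (Suc q) * I p q 0 b - \<i> * of_nat b * I p (Suc q) 0 (b - 1)"
        using IH[of p "Suc q"] by simp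
      finally show "I p (Suc q) 0 (Suc b) = of_nat q * I p (q - 1) 0 (Suc b) + \<i> * of_nat 0 * I p q (0 - 1) (Suc b) 
          - \<i> * of_nat (Suc b) * I p q 0 (Suc b - 1)"
        by (cases q; cases b) (simp_all add: Ib algebra_simps)
    qed
  qed
next
  case (Suc a)
  note IH = Suc.IH
  show ?case
  proof
    have "I (Suc p) q (Suc a) b = I (Suc (Suc p)) q a b + \<i> * I (Suc p) (Suc q) a b" by (rule Ia)
    also have "I (Suc (Suc p)) q a b = of_nat (Suc p) * I p q a b + of_nat a * I (Suc p) q (a - 1) b + of_nat b * I (Suc p) q a (b - 1)"
      using IH[of "Suc p" q b] by simp
    also have "I (Suc p) (Suc q) a b = of_nat p * I (p - 1) (Suc q) a b + of_nat a * I p (Suc q) (a - 1) b + of_nat b * I p (Suc q) a (b - 1)"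
      using IH[of p "Suc q" b] by simp
    finally show "I (Suc p) q (Suc a) b = of_nat p * I (p - 1) q (Suc a) b + of_nat (Suc a) * I p q (Suc a - 1) b 
        + of_nat b * I p q (Suc a) (b - 1)"
      by (cases p; cases a) (simp_all add: Ia algebra_simps)
    have "I p (Suc q) (Suc a) b = I (Suc p) (Suc q) a b + \<i> * I p (Suc (Suc q)) a b" by (rule Ia)
    also have "I (Suc p) (Suc q) a b = of_nat q * I (Suc p) (q - 1) a b + \<i> * of_nat a * I (Suc p) q (a - 1) b - \<i> * of_nat b * I (Suc p) q a (b - 1)"
      using IH[of "Suc p" q b] by simp
    also have "I p (Suc (Suc q)) a b = of_nat (Suc q) * I p q a b + \<i> * of_nat a * I p (Suc q) (a - 1) b - \<i> * of_nat b * I p (Suc q) a (b - 1)"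
      using IH[of p "Suc q" b] by simp
    finally show "I p (Suc q) (Suc a) b = of_nat q * I p (q - 1) (Suc a) b + \<i> * of_nat (Suc a) * I p q (Suc a - 1) b 
        - \<i> * of_nat b * I p q (Suc a) (b - 1)"
      by (cases q; cases a) (simp_all add: Ia algebra_simps)
  qed
qed

text \<open>Under the expectation, multiplication by \<open>Z\<close> acts as twice the Wirtinger
  derivative in \<open>cnj Z\<close>: the two contributions from differentiating \<open>Z\<close>
  cancel because the square of \<open>\<i>\<close> is -1. Each use of \<open>rec_a\<close> removes
  one \<open>Z\<close> and one \<open>cnj Z\<close>, and gives zero if no \<open>cnj Z\<close> is
  left.\<close>

lemma complex_gaussian_moment_recursion:
  fixes I :: "nat \<Rightarrow> nat \<Rightarrow> nat \<Rightarrow> nat \<Rightarrow> complex"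
  assumes I0: "\<And>p q. I p q 0 0 = of_real (std_normal_moment p * std_normal_moment q)"
    and Ia: "\<And>p q a b. I p q (Suc a) b = I (Suc p) q a b + \<i> * I p (Suc q) a b"
    and Ib: "\<And>p q a b. I p q a (Suc b) = I (Suc p) q a b - \<i> * I p (Suc q) a b"
  shows "I 0 0 a b = (if a = b then 2 ^ a * fact a else 0)"
proof -
  have by_parts: "I (Suc 0) 0 a b = of_nat a * I 0 0 (a - 1) b + of_nat b * I 0 0 a (b - 1)"
      "I 0 (Suc 0) a b = \<i> * of_nat a * I 0 0 (a - 1) b - \<i> * of_nat b * I 0 0 a (b - 1)" for a b
    using complex_gaussian_by_parts[of I 0 0 a b, OF assms] by simp_all
  have rec_a: "I 0 0 (Suc a) b = 2 * of_nat b * I 0 0 a (b - 1)" for a b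
    unfolding Ia by_parts by (simp add: algebra_simps)
  have rec_b: "I 0 0 a (Suc b) = 2 * of_nat a * I 0 0 (a - 1) b" for a b
    unfolding Ib by_parts by (simp add: algebra_simps)
  show ?thesis
  proof (induction a arbitrary: b)
    case 0
    show ?case by (cases b) (simp_all add: I0 std_normal_moment_0 rec_b)
  next
    case (Suc a)
    show ?case by (cases b) (simp_all add: rec_a Suc.IH)
  qed
qed

context prob_space
begin

lemma complex_gaussian_moment:
  fixes X Y :: "'a \<Rightarrow> real"
  assumes X: "distributed M lborel X std_normal_density"
    and Y: "distributed M lborel Y std_normal_density"
    and indep: "indep_var borel X borel Y"
  defines "Z \<equiv> \<lambda>\<omega>. Complex (X \<omega>) (Y \<omega>)"
  shows "integrable M (\<lambda>\<omega>. Z \<omega> ^ a * cnj (Z \<omega>) ^ b)"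
    and "expectation (\<lambda>\<omega>. Z \<omega> ^ a * cnj (Z \<omega>) ^ b) = (if a = b then 2 ^ a * fact a else 0)"
proof -
  let ?x = "\<lambda>\<omega>. complex_of_real (X \<omega>)" and ?y = "\<lambda>\<omega>. complex_of_real (Y \<omega>)"
  have Z: "Z \<omega> = ?x \<omega> + \<i> * ?y \<omega>" "cnj (Z \<omega>) = ?x \<omega> - \<i> * ?y \<omega>" for \<omega>
    by (simp_all add: Z_def Complex_eq)
  \<comment> \<open>The powers of \<open>X\<close> and \<open>Y\<close> close the family under
    \<open>Fa\<close> and \<open>Fb\<close>, so integrability and expectations reduce to
    \<open>a = b = 0\<close>, where independence of \<open>X\<close> and \<open>Y\<close>
    applies.\<close>
  define F where "F p q a b \<omega> = ?x \<omega> ^ p * ?y \<omega> ^ q * Z \<omega> ^ a * cnj (Z \<omega>) ^ b" for p q a b \<omega>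
  have Fa: "F p q (Suc a) b = (\<lambda>\<omega>. F (Suc p) q a b \<omega> + \<i> * F p (Suc q) a b \<omega>)" for p q a b
    by (simp add: fun_eq_iff F_def Z algebra_simps)
  have Fb: "F p q a (Suc b) = (\<lambda>\<omega>. F (Suc p) q a b \<omega> - \<i> * F p (Suc q) a b \<omega>)" for p q a b
    by (simp add: fun_eq_iff F_def Z algebra_simps)
  have rv: "integrable M (\<lambda>\<omega>. W \<omega> ^ p) \<and> expectation (\<lambda>\<omega>. W \<omega> ^ p) = std_normal_moment p"
    if "distributed M lborel W std_normal_density" for W :: "'a \<Rightarrow> real" and p
    using distributed_integrable[OF that, of "\<lambda>x. x ^ p"] distributed_integral[OF that, of "\<lambda>x. x ^ p"]
      integrable_std_normal_moment[of p] by (simp add: std_normal_moment_def)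
  have ind: "indep_var borel (\<lambda>\<omega>. X \<omega> ^ p) borel (\<lambda>\<omega>. Y \<omega> ^ q)" for p q
    using indep_var_compose[OF indep, of "\<lambda>x. x ^ p" borel "\<lambda>x. x ^ q" borel]
    by (simp add: comp_def)
  have F0: "F p q 0 0 = (\<lambda>\<omega>. complex_of_real (X \<omega> ^ p * Y \<omega> ^ q))" for p q
    by (simp add: F_def fun_eq_iff)
  have int0: "integrable M (F p q 0 0)" for p q
    unfolding F0 by (intro integrable_of_real indep_var_integrable ind) (simp_all add: rv X Y)
  have E0: "expectation (F p q 0 0) = of_real (std_normal_moment p * std_normal_moment q)" for p q
    unfolding F0 integral_complex_of_real
    by (subst indep_var_lebesgue_integral[OF ind]) (simp_all add: rv X Y)
  have int: "integrable M (F p q a b)" for p q a b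
  proof (induction a arbitrary: p q b)
    case 0
    show ?case
      by (induction b arbitrary: p q) (simp_all add: int0 Fb)
  qed (simp add: Fa)
  note moment = complex_gaussian_moment_recursion[of "\<lambda>p q a b. expectation (F p q a b)" a b]
  have "expectation (F 0 0 a b) = (if a = b then 2 ^ a * fact a else 0)"
    by (rule moment) (simp_all only: E0 Fa Fb Bochner_Integration.integral_add
      Bochner_Integration.integral_diff integral_mult_right_zero int integrable_mult_right simp_thms)
  with int[of 0 0 a b] show "integrable M (\<lambda>\<omega>. Z \<omega> ^ a * cnj (Z \<omega>) ^ b)"
    and "expectation (\<lambda>\<omega>. Z \<omega> ^ a * cnj (Z \<omega>) ^ b) = (if a = b then 2 ^ a * fact a else 0)"
    by (simp_all add: F_def [abs_def])
qed

end

section \<open>Walks and their edges\<close>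

definition walks :: "nat \<Rightarrow> nat \<Rightarrow> (nat \<Rightarrow> nat) set" where
  "walks N i = {..i} \<rightarrow>\<^sub>E {..<N}"

text \<open>The expectation sees only how often each matrix entry is used, hence a multiset. The
  order of the steps is lost, and \<open>rearrangements\<close> measures how much freedom that
  leaves.\<close>

definition edges :: "nat \<Rightarrow> (nat \<Rightarrow> nat) \<Rightarrow> (nat \<times> nat) multiset" where
  "edges i P = image_mset (\<lambda>t. (P t, P (Suc t))) (mset_set {..<i})"

text \<open>For independent circularly symmetric complex Gaussians z_e with mean square modulus one,
  this is the expectation of the product of |z_e|^2 over \<open>A\<close>.\<close>

definition edge_moment :: "(nat \<times> nat) multiset \<Rightarrow> real" where
  "edge_moment A = (\<Prod>e\<in>set_mset A. fact (count A e))"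

text \<open>The last vertex of a walk is exempted because the starting vector may be concentrated on a
  single coordinate, where all walks of interest then end.\<close>

definition injective_before_end :: "nat \<Rightarrow> nat \<Rightarrow> (nat \<Rightarrow> nat) \<Rightarrow> (nat \<Rightarrow> nat) \<Rightarrow> bool" where
  "injective_before_end i j P Q \<longleftrightarrow>
     (\<forall>s<i. (\<forall>t\<le>i. P s = P t \<longrightarrow> s = t) \<and> (\<forall>t\<le>j. P s \<noteq> Q t)) \<and>
     (\<forall>s<j. (\<forall>t\<le>j. Q s = Q t \<longrightarrow> s = t) \<and> (\<forall>t\<le>i. Q s \<noteq> P t))"

lemma finite_walks [simp]: "finite (walks N i)"
  by (simp add: walks_def finite_PiE)

lemma walks_less: "P \<in> walks N i \<Longrightarrow> t \<le> i \<Longrightarrow> P t < N"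
  by (auto simp: walks_def PiE_def Pi_def)

lemma walks_eqI: "P \<in> walks N i \<Longrightarrow> Q \<in> walks N i \<Longrightarrow> (\<And>t. t \<le> i \<Longrightarrow> P t = Q t) \<Longrightarrow> P = Q"
  unfolding walks_def by (rule PiE_ext) auto

lemma edges_0 [simp]: "edges 0 P = {#}"
  by (simp add: edges_def)

lemma edges_Suc: "edges (Suc i) P = add_mset (P i, P (Suc i)) (edges i P)"
  by (simp add: edges_def lessThan_Suc)

lemma size_edges [simp]: "size (edges i P) = i"
  by (simp add: edges_def)

lemma mem_edges: "e \<in># edges i P \<longleftrightarrow> (\<exists>t<i. e = (P t, P (Suc t)))"
  by (auto simp: edges_def)

lemma edges_subset: "P \<in> walks N i \<Longrightarrow> set_mset (edges i P) \<subseteq> {..<N} \<times> {..<N}"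
  by (auto simp: mem_edges intro!: walks_less[of P N i])

lemma edges_eq_mset: "edges i P = mset (map (\<lambda>t. (P t, P (Suc t))) [0..<i])"
  by (simp add: edges_def mset_upt atLeast0LessThan)

text \<open>Either side lists all \<open>i + 1\<close> vertices of the walk.\<close>

lemma edges_ends: "image_mset fst (edges i P) + {#P i#} = {#P 0#} + image_mset snd (edges i P)"
  by (induction i) (auto simp: edges_Suc)

lemma walk_ends_eq:
  assumes "edges i P = edges i Q" "P 0 = Q 0"
  shows "P i = Q i"
proof -
  have "image_mset fst (edges i Q) + {#P i#} = image_mset fst (edges i Q) + {#Q i#}"
    using edges_ends[of i P] edges_ends[of i Q] assms by (simp only:)
  then show ?thesis by simp
qed

text \<open>Tails and heads of the edges determine the balance of starting points against end
  points. Only the multiset of end points is determined, since two walks may exchange theirs; this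
  is enough for a product of moduli of \<open>f\<close>.\<close>

lemma walk_pair_ends_eq:
  assumes eq: "edges i P + edges j Q' = edges j Q + edges i P'" and "P 0 = Q 0" "P' 0 = Q' 0"
  shows "{#P i, Q' j#} = {#Q j, P' i#}"
proof -
  have fst: "image_mset fst (edges i P) + image_mset fst (edges j Q')
      = image_mset fst (edges j Q) + image_mset fst (edges i P')"
    using arg_cong[OF eq, of "image_mset fst"] by simp
  have snd: "image_mset snd (edges i P) + image_mset snd (edges j Q')
      = image_mset snd (edges j Q) + image_mset snd (edges i P')"
    using arg_cong[OF eq, of "image_mset snd"] by simp
  have "(image_mset fst (edges i P) + image_mset fst (edges j Q')) + {#P i, Q' j#}
      = (image_mset fst (edges i P) + {#P i#}) + (image_mset fst (edges j Q') + {#Q' j#})"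
    by simp
  also have "\<dots> = {#P 0, Q' 0#} + (image_mset snd (edges i P) + image_mset snd (edges j Q'))"
    unfolding edges_ends by simp
  also have "\<dots> = {#Q 0, P' 0#} + (image_mset snd (edges j Q) + image_mset snd (edges i P'))"
    using snd assms by simp
  also have "\<dots> = (image_mset fst (edges j Q) + {#Q j#}) + (image_mset fst (edges i P') + {#P' i#})"
    unfolding edges_ends by simp
  also have "\<dots> = (image_mset fst (edges i P) + image_mset fst (edges j Q')) + {#Q j, P' i#}"
    unfolding fst by simp
  finally show ?thesis by (simp only: add_left_cancel)
qed

lemma injective_before_end_commute:
  "injective_before_end i j P Q \<longleftrightarrow> injective_before_end j i Q P"
  unfolding injective_before_end_def by (rule conj_commute)

text \<open>Every non-final vertex has exactly one outgoing edge, so a walk using only edges of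
  \<open>P\<close> and \<open>Q'\<close> has no choice.\<close>

lemma walk_forced:
  assumes inj: "injective_before_end i j P Q'"
    and sub: "set_mset (edges m Q) \<subseteq> set_mset (edges i P + edges j Q')"
    and start: "Q 0 = P 0" and t: "t \<le> m"
  shows "t \<le> i \<and> Q t = P t"
  using t
proof (induction t)
  case (Suc t)
  then have IH: "t \<le> i" "Q t = P t" by auto
  from Suc.prems have "(Q t, Q (Suc t)) \<in># edges m Q"
    unfolding mem_edges by (intro exI[of _ t]) simp
  with sub have "(Q t, Q (Suc t)) \<in># edges i P \<or> (Q t, Q (Suc t)) \<in># edges j Q'"
    by auto
  then consider s where "s < i" "Q t = P s" "Q (Suc t) = P (Suc s)"
    | s where "s < j" "Q t = Q' s"
    by (auto simp: mem_edges)
  then show ?case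
  proof cases
    case (1 s)
    with inj IH have "s = t" unfolding injective_before_end_def by metis
    with 1 show ?thesis by simp
  next
    case (2 s)
    with inj IH show ?thesis unfolding injective_before_end_def by metis
  qed
qed (simp add: start)

text \<open>Forcing \<open>Q\<close> along \<open>P\<close> yields \<open>j \<le> i\<close> and
  forcing \<open>P'\<close> along \<open>Q'\<close> yields \<open>i \<le> j\<close>, so equality of
  the lengths comes with the argument.\<close>

lemma walk_pair_forced:
  assumes inj: "injective_before_end i j P Q'"
    and eq: "edges i P + edges j Q' = edges j Q + edges i P'"
    and start: "Q 0 = P 0" "P' 0 = Q' 0"
  shows "i = j" and "t \<le> i \<Longrightarrow> Q t = P t" and "t \<le> i \<Longrightarrow> P' t = Q' t"
proof -
  have Q: "t \<le> i \<and> Q t = P t" if "t \<le> j" for t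
    by (rule walk_forced[where m = j, OF inj _ _ that]) (simp_all add: eq start)
  have "injective_before_end j i Q' P"
    using inj injective_before_end_commute by blast
  then have P': "t \<le> j \<and> P' t = Q' t" if "t \<le> i" for t
    by (rule walk_forced[where m = i, OF _ _ _ that])
      (simp_all add: start eq add.commute[of "edges j Q'"])
  from Q[of j] P'[of i] show "i = j" by auto
  with Q P' show "t \<le> i \<Longrightarrow> Q t = P t" "t \<le> i \<Longrightarrow> P' t = Q' t" by auto
qed

lemma edge_moment_ge_1: "1 \<le> edge_moment A"
  unfolding edge_moment_def by (rule prod_ge_1) simp

text \<open>Edges with distinct tails are distinct, so every multiplicity is one.\<close>

lemma edge_moment_injective:
  assumes inj: "injective_before_end i j P Q"
  shows "edge_moment (edges i P + edges j Q) = 1"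
proof -
  let ?es = "map (\<lambda>t. (P t, P (Suc t))) [0..<i] @ map (\<lambda>t. (Q t, Q (Suc t))) [0..<j]"
  have P: "s = t" if "P s = P t" "s < i" "t < i" for s t
    using inj that unfolding injective_before_end_def by (meson less_imp_le)
  have Q: "s = t" if "Q s = Q t" "s < j" "t < j" for s t
    using inj that unfolding injective_before_end_def by (meson less_imp_le)
  have PQ: "P s \<noteq> Q t" if "s < i" "t < j" for s t
    using inj that unfolding injective_before_end_def by (meson less_imp_le)
  have "inj_on (\<lambda>t. (P t, P (Suc t))) {0..<i}" "inj_on (\<lambda>t. (Q t, Q (Suc t))) {0..<j}"
    by (rule inj_onI, rule P, simp_all) (rule inj_onI, rule Q, simp_all)
  moreover have "(\<lambda>t. (P t, P (Suc t))) ` {0..<i} \<inter> (\<lambda>t. (Q t, Q (Suc t))) ` {0..<j} = {}"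
    using PQ by auto
  ultimately have "distinct ?es"
    by (simp add: distinct_map)
  then have "\<forall>e. count (mset ?es) e = (if e \<in> set ?es then 1 else 0)"
    unfolding distinct_count_atmost_1 .
  moreover have "edges i P + edges j Q = mset ?es"
    by (simp add: edges_eq_mset)
  ultimately show ?thesis
    unfolding edge_moment_def by (intro prod.neutral ballI) (simp only: set_mset_mset if_True fact_1)
qed

text \<open>For fixed \<open>P\<close> and \<open>Q'\<close>, the walks \<open>Q\<close>,
  \<open>P'\<close> that complete them to a term of nonzero expectation in the quartic sum.\<close>

definition rearrangements :: "nat \<Rightarrow> nat \<Rightarrow> nat \<Rightarrow> (nat \<Rightarrow> nat) \<Rightarrow> (nat \<Rightarrow> nat)
    \<Rightarrow> ((nat \<Rightarrow> nat) \<times> (nat \<Rightarrow> nat)) set" where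
  "rearrangements N i j P Q' = {(Q, P') \<in> walks N j \<times> walks N i. P 0 = Q 0 \<and> P' 0 = Q' 0 \<and>
     edges i P + edges j Q' = edges j Q + edges i P'}"

section \<open>Number of rearrangements against their Gaussian moment\<close>

lemma walk_eqI_edges:
  assumes "P \<in> walks N i" "Q \<in> walks N i" "P 0 = Q 0"
    and "map (\<lambda>t. (P t, P (Suc t))) [0..<i] = map (\<lambda>t. (Q t, Q (Suc t))) [0..<i]"
  shows "P = Q"
proof (rule walks_eqI[OF assms(1,2)])
  fix t assume "t \<le> i"
  with assms(3,4) show "P t = Q t" by (cases t) (auto simp: map_eq_conv)
qed

text \<open>The steps of \<open>Q\<close> followed by those of \<open>P'\<close> form an ordering of
  the edge multiset, and with the given starting points this ordering determines both walks. A
  multiset of size \<open>i + j\<close> has \<open>fact (i + j)\<close> orderings divided by the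
  product of the factorials of its multiplicities, and that product is exactly
  \<open>edge_moment\<close>.\<close>

lemma rearrangements_moment_le:
  "(\<Sum>x\<in>rearrangements N i j P Q'. edge_moment (edges i P + edges j Q')) \<le> fact (i + j)"
proof -
  let ?A = "edges i P + edges j Q'"
  let ?l = "\<lambda>(Q, P'). map (\<lambda>t. (Q t, Q (Suc t))) [0..<j] @ map (\<lambda>t. (P' t, P' (Suc t))) [0..<i]"
  have "inj_on ?l (rearrangements N i j P Q')"
  proof (rule inj_onI)
    fix x y assume x: "x \<in> rearrangements N i j P Q'" and y: "y \<in> rearrangements N i j P Q'" and eq: "?l x = ?l y"
    obtain A B C D where xy: "x = (A, B)" "y = (C, D)" by (cases x, cases y)
    have maps: "map (\<lambda>t. (A t, A (Suc t))) [0..<j] = map (\<lambda>t. (C t, C (Suc t))) [0..<j] \<and>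
        map (\<lambda>t. (B t, B (Suc t))) [0..<i] = map (\<lambda>t. (D t, D (Suc t))) [0..<i]"
      using eq unfolding xy prod.case by simp
    have walks: "A \<in> walks N j" "C \<in> walks N j" "A 0 = C 0" "B \<in> walks N i" "D \<in> walks N i" "B 0 = D 0"
      using x y by (simp_all add: xy rearrangements_def)
    from walk_eqI_edges[OF walks(1-3)] walk_eqI_edges[OF walks(4-6)] maps
    show "x = y" unfolding xy by blast
  qed
  moreover have "?l ` rearrangements N i j P Q' \<subseteq> permutations_of_multiset ?A"
    by (auto simp: rearrangements_def permutations_of_multiset_def edges_eq_mset)
  ultimately have "card (rearrangements N i j P Q') \<le> card (permutations_of_multiset ?A)"
    by (intro card_inj_on_le) auto
  then have "real (card (rearrangements N i j P Q')) * edge_moment ?A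
      \<le> real (card (permutations_of_multiset ?A)) * edge_moment ?A"
    using edge_moment_ge_1[of ?A] by (intro mult_right_mono) auto
  also have "\<dots> = real (fact (size ?A))"
    unfolding card_permutations_of_multiset_aux[symmetric] edge_moment_def by simp
  finally show ?thesis by simp
qed

lemma rearrangements_moment_injective:
  assumes inj: "injective_before_end i j P Q'" and "P \<in> walks N i" "Q' \<in> walks N j"
  shows "(\<Sum>x\<in>rearrangements N i j P Q'. edge_moment (edges i P + edges j Q')) \<le> of_bool (i = j)"
proof -
  have "rearrangements N i j P Q' \<subseteq> (if i = j then {(P, Q')} else {})"
  proof
    fix x assume "x \<in> rearrangements N i j P Q'"
    then obtain Q P' where x: "x = (Q, P')" "Q \<in> walks N j" "P' \<in> walks N i" "Q 0 = P 0" "P' 0 = Q' 0"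
      "edges i P + edges j Q' = edges j Q + edges i P'"
      by (auto simp: rearrangements_def)
    note forced = walk_pair_forced[OF inj x(6,4,5)]
    from forced(1) have "i = j" .
    moreover from this forced x assms have "Q = P" "P' = Q'" by (auto intro!: walks_eqI)
    ultimately show "x \<in> (if i = j then {(P, Q')} else {})" using x by simp
  qed
  then have "(\<Sum>x\<in>rearrangements N i j P Q'. 1) \<le> (\<Sum>x\<in>(if i = j then {(P, Q')} else {}). 1 :: real)"
    by (intro sum_mono2) (auto split: if_splits)
  then show ?thesis using edge_moment_injective[OF inj] by (auto split: if_splits)
qed

section \<open>Counting walks\<close>

text \<open>A collision makes the value at \<open>s\<close> a function of the value at
  \<open>t\<close>. Since \<open>s\<close> carries weight one, summing it freely would have
  contributed the factor \<open>card V\<close>.\<close>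

lemma sum_PiE_collision:
  fixes w :: "'i \<Rightarrow> 'v \<Rightarrow> real"
  assumes fin: "finite I" "finite V" and st: "s \<in> I" "t \<in> I" "s \<noteq> t"
    and ws: "\<And>v. v \<in> V \<Longrightarrow> w s v = 1"
  shows "real (card V) * (\<Sum>H | H \<in> I \<rightarrow>\<^sub>E V \<and> H s = H t. \<Prod>p\<in>I. w p (H p)) = (\<Prod>p\<in>I. \<Sum>v\<in>V. w p v)"
proof -
  let ?J = "I - {s}"
  have "(\<Sum>H | H \<in> I \<rightarrow>\<^sub>E V \<and> H s = H t. \<Prod>p\<in>I. w p (H p)) = (\<Sum>G\<in>?J \<rightarrow>\<^sub>E V. \<Prod>p\<in>?J. w p (G p))"
  proof (rule sum.reindex_bij_witness[where i = "\<lambda>G. G(s := G t)" and j = "\<lambda>H. H(s := undefined)"])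
    fix H assume H: "H \<in> {H \<in> I \<rightarrow>\<^sub>E V. H s = H t}"
    with st ws have "w s (H s) = 1" by (auto simp: PiE_def Pi_def)
    then show "(\<Prod>p\<in>?J. w p ((H(s := undefined)) p)) = (\<Prod>p\<in>I. w p (H p))"
      unfolding prod.remove[OF fin(1) st(1)] by (auto intro!: prod.cong)
  qed (use st in \<open>auto simp: PiE_def Pi_def extensional_def fun_eq_iff\<close>)
  also have "\<dots> = (\<Prod>p\<in>?J. \<Sum>v\<in>V. w p v)"
    using fin by (intro prod_sum_PiE[symmetric]) auto
  finally have "(\<Sum>H | H \<in> I \<rightarrow>\<^sub>E V \<and> H s = H t. \<Prod>p\<in>I. w p (H p)) = (\<Prod>p\<in>?J. \<Sum>v\<in>V. w p v)" .
  moreover have "real (card V) = (\<Sum>v\<in>V. w s v)"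
    using ws by simp
  ultimately show ?thesis
    by (simp only: prod.remove[OF fin(1) st(1), of "\<lambda>p. \<Sum>v\<in>V. w p v"])
qed

lemma prod_atMost_last:
  fixes x y :: "'a :: comm_semiring_1" and m :: nat
  shows "(\<Prod>p\<le>m. if p = m then x else y) = x * y ^ m"
proof -
  have "(\<Prod>p<m. if p = m then x else y) = (\<Prod>p<m. y)"
    by (intro prod.cong) auto
  then show ?thesis
    by (simp add: lessThan_Suc_atMost[symmetric] mult.commute)
qed

lemma sum_walks_end:
  fixes w :: "nat \<Rightarrow> real"
  shows "(\<Sum>P\<in>walks N i. w (P i)) = real N ^ i * (\<Sum>v<N. w v)"
proof -
  have "(\<Sum>P\<in>walks N i. w (P i)) = (\<Sum>P\<in>walks N i. \<Prod>p\<in>{..i}. if p = i then w (P p) else 1)"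
    by (intro sum.cong refl) (simp add: prod.delta)
  also have "\<dots> = (\<Prod>p\<in>{..i}. \<Sum>v<N. if p = i then w v else 1)"
    unfolding walks_def by (rule prod_sum_PiE[symmetric]) auto
  also have "\<dots> = (\<Prod>p\<in>{..i}. if p = i then \<Sum>v<N. w v else real N)"
    by (intro prod.cong) auto
  finally show ?thesis by (simp add: prod_atMost_last)
qed

text \<open>Two walks as one function on a disjoint sum of positions, so that collisions inside one
  walk and between the two are a single case.\<close>

abbreviation join :: "(nat \<Rightarrow> nat) \<Rightarrow> (nat \<Rightarrow> nat) \<Rightarrow> nat + nat \<Rightarrow> nat" where
  "join P Q \<equiv> case_sum P Q"

text \<open>The weights sit on the two final vertices. Therefore \<open>s\<close> ranges over
  non-final positions, where the weight is one, while \<open>t\<close> may be final.\<close>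

lemma sum_walk_pairs_collision:
  fixes w :: "nat \<Rightarrow> real"
  assumes s: "s \<in> Inl ` {..<i} \<union> Inr ` {..<j}" and t: "t \<in> {..i} <+> {..j}" "s \<noteq> t"
  shows "real N * (\<Sum>(P, Q) | (P, Q) \<in> walks N i \<times> walks N j \<and> join P Q s = join P Q t. w (P i) * w (Q j))
     = real N ^ (i + j) * (\<Sum>v<N. w v)\<^sup>2"
proof -
  let ?I = "{..i} <+> {..j}"
  define u :: "nat + nat \<Rightarrow> nat \<Rightarrow> real"
    where "u = case_sum (\<lambda>p v. if p = i then w v else 1) (\<lambda>p v. if p = j then w v else 1)"
  have prodI: "(\<Prod>p\<in>?I. f p) = (\<Prod>p\<le>i. f (Inl p)) * (\<Prod>p\<le>j. f (Inr p))" for f :: "nat + nat \<Rightarrow> real"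
    by (simp add: prod.Plus)
  have "(\<Sum>(P, Q) | (P, Q) \<in> walks N i \<times> walks N j \<and> join P Q s = join P Q t. w (P i) * w (Q j))
      = (\<Sum>H | H \<in> ?I \<rightarrow>\<^sub>E {..<N} \<and> H s = H t. \<Prod>p\<in>?I. u p (H p))"
  proof (rule sum.reindex_bij_witness[where i = "\<lambda>H. (H \<circ> Inl, H \<circ> Inr)" and j = "\<lambda>(P, Q). join P Q"])
    fix a assume "a \<in> {(P, Q). (P, Q) \<in> walks N i \<times> walks N j \<and> join P Q s = join P Q t}"
    then obtain P Q where a: "a = (P, Q)" and PQ: "P \<in> walks N i" "Q \<in> walks N j" "join P Q s = join P Q t"
      by blast
    show "(\<lambda>H. (H \<circ> Inl, H \<circ> Inr)) (case a of (P, Q) \<Rightarrow> join P Q) = a"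
      by (simp add: a fun_eq_iff)
    have "join P Q \<in> ?I \<rightarrow>\<^sub>E {..<N}"
    proof (rule PiE_I)
      fix x assume "x \<in> ?I"
      with PQ show "join P Q x \<in> {..<N}" by (cases x) (auto intro: walks_less)
    next
      fix x assume "x \<notin> ?I"
      with PQ show "join P Q x = undefined" unfolding walks_def by (cases x) (auto intro: PiE_arb)
    qed
    with PQ show "(case a of (P, Q) \<Rightarrow> join P Q) \<in> {H \<in> ?I \<rightarrow>\<^sub>E {..<N}. H s = H t}"
      by (simp add: a)
    show "(\<Prod>p\<in>?I. u p ((case a of (P, Q) \<Rightarrow> join P Q) p)) = (case a of (P, Q) \<Rightarrow> w (P i) * w (Q j))"
      by (simp add: a prodI u_def)
  next
    fix H assume "H \<in> {H \<in> ?I \<rightarrow>\<^sub>E {..<N}. H s = H t}"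
    then have H: "H \<in> ?I \<rightarrow>\<^sub>E {..<N}" "H s = H t" by auto
    show join: "(case (H \<circ> Inl, H \<circ> Inr) of (P, Q) \<Rightarrow> join P Q) = H"
      by (simp add: fun_eq_iff split: sum.split)
    have "H \<circ> Inl \<in> walks N i" "H \<circ> Inr \<in> walks N j"
      unfolding walks_def using H(1) by (auto simp: PiE_def Pi_def extensional_def)
    with join H show "(H \<circ> Inl, H \<circ> Inr) \<in> {(P, Q). (P, Q) \<in> walks N i \<times> walks N j \<and> join P Q s = join P Q t}"
      by simp
  qed
  also have "real N * \<dots> = (\<Prod>p\<in>?I. \<Sum>v<N. u p v)"
  proof -
    have "u s v = 1" for v using s by (auto simp: u_def)
    moreover have "s \<in> ?I" using s by auto
    ultimately show ?thesis using t sum_PiE_collision[of ?I "{..<N}" s t u] by simp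
  qed
  also have "\<dots> = (\<Prod>p\<le>i. if p = i then \<Sum>v<N. w v else real N) * (\<Prod>p\<le>j. if p = j then \<Sum>v<N. w v else real N)"
    unfolding prodI by (intro arg_cong2[where f = "(*)"] prod.cong) (auto simp: u_def)
  also have "\<dots> = real N ^ (i + j) * (\<Sum>v<N. w v)\<^sup>2"
    unfolding prod_atMost_last by (simp add: power_add power2_eq_square)
  finally show ?thesis .
qed

text \<open>Union bound over the colliding positions. There are \<open>i + j + 2\<close> positions
  in all, hence at most the square of this many pairs \<open>(s, t)\<close>, and each collision
  costs one factor \<open>N\<close>.\<close>

lemma sum_walk_pairs_not_injective:
  fixes w :: "nat \<Rightarrow> real"
  assumes w: "\<And>v. 0 \<le> w v"
  shows "real N * (\<Sum>(P, Q) | (P, Q) \<in> walks N i \<times> walks N j \<and> \<not> injective_before_end i j P Q. w (P i) * w (Q j))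
     \<le> (real i + real j + 2)\<^sup>2 * (real N ^ (i + j) * (\<Sum>v<N. w v)\<^sup>2)"
proof -
  let ?W = "walks N i \<times> walks N j" and ?I = "{..i} <+> {..j}"
  let ?S = "Inl ` {..<i} \<union> Inr ` {..<j} :: (nat + nat) set"
  let ?K = "{(s, t) \<in> ?S \<times> ?I. s \<noteq> t}"
  let ?C = "\<lambda>(s, t). {(P, Q) \<in> ?W. join P Q s = join P Q t}"
  let ?f = "\<lambda>(P, Q). w (P i) * w (Q j)"
  let ?B = "{(P, Q) \<in> ?W. \<not> injective_before_end i j P Q}"
  have SI: "?S \<subseteq> ?I" by auto
  have finK: "finite ?K" by (rule finite_subset[of _ "?S \<times> ?I"]) auto
  have cov: "\<exists>k\<in>?K. x \<in> ?C k" if "x \<in> ?B" for x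
  proof -
    obtain P Q where PQ: "x = (P, Q)" by (cases x)
    with that have x: "x = (P, Q)" "(P, Q) \<in> ?W" "\<not> injective_before_end i j P Q" by auto
    from x(3) consider
      s t where "s < i" "t \<le> i" "P s = P t" "s \<noteq> t"
      | s t where "s < i" "t \<le> j" "P s = Q t"
      | s t where "s < j" "t \<le> j" "Q s = Q t" "s \<noteq> t"
      | s t where "s < j" "t \<le> i" "Q s = P t"
      unfolding injective_before_end_def by blast
    then show ?thesis
    proof cases
      case (1 s t) then show ?thesis using x by (intro bexI[of _ "(Inl s, Inl t)"]) auto
    next
      case (2 s t) then show ?thesis using x by (intro bexI[of _ "(Inl s, Inr t)"]) auto
    next
      case (3 s t) then show ?thesis using x by (intro bexI[of _ "(Inr s, Inr t)"]) auto
    next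
      case (4 s t) then show ?thesis using x by (intro bexI[of _ "(Inr s, Inl t)"]) auto
    qed
  qed
  have f0: "0 \<le> ?f x" for x using w by (auto split: prod.split)
  have if0: "0 \<le> (\<Sum>k\<in>?K. if x \<in> ?C k then ?f x else 0)" for x
  proof (rule sum_nonneg)
    show "0 \<le> (if x \<in> ?C k then ?f x else 0)" for k
      using f0[of x] by (cases "x \<in> ?C k") (simp_all only: if_True if_False order_refl)
  qed
  have "(\<Sum>x\<in>?B. ?f x) \<le> (\<Sum>x\<in>?B. \<Sum>k\<in>?K. if x \<in> ?C k then ?f x else 0)"
  proof (rule sum_mono)
    fix x assume "x \<in> ?B"
    then obtain k where k: "k \<in> ?K" "x \<in> ?C k" using cov by blast
    have "?f x = (\<Sum>k\<in>{k}. if x \<in> ?C k then ?f x else 0)" using k by simp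
    also have "\<dots> \<le> (\<Sum>k\<in>?K. if x \<in> ?C k then ?f x else 0)"
      by (rule sum_mono2[OF finK]) (use k f0 in auto)
    finally show "?f x \<le> (\<Sum>k\<in>?K. if x \<in> ?C k then ?f x else 0)" .
  qed
  also have "\<dots> \<le> (\<Sum>x\<in>?W. \<Sum>k\<in>?K. if x \<in> ?C k then ?f x else 0)"
    by (rule sum_mono2) (use if0 in \<open>simp_all only: finite_cartesian_product finite_walks, blast\<close>)
  also have "\<dots> = (\<Sum>k\<in>?K. \<Sum>x\<in>?W. if x \<in> ?C k then ?f x else 0)"
    by (rule sum.swap)
  also have "\<dots> = (\<Sum>k\<in>?K. \<Sum>x\<in>?C k. ?f x)"
    by (intro sum.cong refl sum.mono_neutral_cong_right) auto
  finally have "real N * (\<Sum>x\<in>?B. ?f x) \<le> (\<Sum>k\<in>?K. real N * (\<Sum>x\<in>?C k. ?f x))"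
    by (simp add: mult_left_mono flip: sum_distrib_left)
  also have "\<dots> = (\<Sum>k\<in>?K. real N ^ (i + j) * (\<Sum>v<N. w v)\<^sup>2)"
    using sum_walk_pairs_collision[of _ i j _ N w]
    by (intro sum.cong refl) (auto simp: case_prod_unfold)
  also have "\<dots> = real (card ?K) * (real N ^ (i + j) * (\<Sum>v<N. w v)\<^sup>2)" by simp
  also have "\<dots> \<le> (real i + real j + 2)\<^sup>2 * (real N ^ (i + j) * (\<Sum>v<N. w v)\<^sup>2)"
  proof (rule mult_right_mono)
    have "card ?K \<le> card (?I \<times> ?I)" using SI by (intro card_mono) auto
    also have "\<dots> = (i + j + 2)\<^sup>2" by (simp add: card_cartesian_product card_Plus power2_eq_square)
    finally have "real (card ?K) \<le> real ((i + j + 2)\<^sup>2)" by (simp only: of_nat_le_iff)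
    then show "real (card ?K) \<le> (real i + real j + 2)\<^sup>2" by (simp add: add_ac)
  qed simp
  finally show ?thesis by (simp add: case_prod_unfold add_ac)
qed

section \<open>Walk expansion of the Krylov Gram matrix\<close>

definition apply_mat :: "nat \<Rightarrow> (nat \<times> nat \<Rightarrow> complex) \<Rightarrow> (nat \<Rightarrow> complex) \<Rightarrow> nat \<Rightarrow> complex" where
  "apply_mat N g f v = (\<Sum>u<N. g (v, u) * f u)"

definition walk_weight :: "(nat \<times> nat \<Rightarrow> complex) \<Rightarrow> nat \<Rightarrow> (nat \<Rightarrow> nat) \<Rightarrow> complex" where
  "walk_weight g i P = (\<Prod>t<i. g (P t, P (Suc t)))"

lemma walk_weight_edges: "walk_weight g i P = (\<Prod>e\<in>#edges i P. g e)"
  by (simp add: walk_weight_def edges_def image_mset.compositionality comp_def prod_unfold_prod_mset)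

lemma apply_mat_power_walks:
  "v < N \<Longrightarrow> (apply_mat N g ^^ i) f v = (\<Sum>P | P \<in> walks N i \<and> P 0 = v. walk_weight g i P * f (P i))"
proof (induction i arbitrary: f)
  case 0
  have "{P \<in> walks N 0. P 0 = v} = {\<lambda>x\<in>{..0}. v}"
    using 0 by (auto simp: walks_def PiE_def Pi_def extensional_def fun_eq_iff)
  then show ?case by (simp add: walk_weight_def)
next
  case (Suc i)
  let ?A = "{P \<in> walks N i. P 0 = v}"
  \<comment> \<open>The last step of a walk is the innermost application of the matrix. It is
    absorbed into the vector, which is why the induction generalizes over \<open>f\<close>.\<close>
  have "(apply_mat N g ^^ Suc i) f v = (apply_mat N g ^^ i) (apply_mat N g f) v"
    by (simp add: funpow_swap1)
  also have "\<dots> = (\<Sum>P\<in>?A. \<Sum>u<N. walk_weight g i P * g (P i, u) * f u)"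
    by (simp add: Suc apply_mat_def sum_distrib_left mult.assoc)
  also have "\<dots> = (\<Sum>(P, u)\<in>?A \<times> {..<N}. walk_weight g i P * g (P i, u) * f u)"
    by (rule sum.cartesian_product)
  also have "\<dots> = (\<Sum>P | P \<in> walks N (Suc i) \<and> P 0 = v. walk_weight g (Suc i) P * f (P (Suc i)))"
  proof (rule sum.reindex_bij_witness[where i = "\<lambda>H. (H(Suc i := undefined), H (Suc i))"
        and j = "\<lambda>(P, u). P(Suc i := u)"])
    fix a assume "a \<in> ?A \<times> {..<N}"
    then obtain P u where a: "a = (P, u)" "P \<in> walks N i" "P 0 = v" "u < N" by auto
    have "P (Suc i) = undefined" using a(2) unfolding walks_def by (rule PiE_arb) simp
    then show "((case a of (P, u) \<Rightarrow> P(Suc i := u))(Suc i := undefined),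
        (case a of (P, u) \<Rightarrow> P(Suc i := u)) (Suc i)) = a"
      by (simp add: a fun_eq_iff)
    show "(case a of (P, u) \<Rightarrow> P(Suc i := u)) \<in> {P \<in> walks N (Suc i). P 0 = v}"
      using a by (auto simp: walks_def atMost_Suc PiE_def Pi_def extensional_def)
    have "walk_weight g (Suc i) (P(Suc i := u)) = walk_weight g i P * g (P i, u)"
      by (simp add: walk_weight_def)
    then show "walk_weight g (Suc i) (case a of (P, u) \<Rightarrow> P(Suc i := u)) * f ((case a of (P, u) \<Rightarrow> P(Suc i := u)) (Suc i))
        = (case a of (P, u) \<Rightarrow> walk_weight g i P * g (P i, u) * f u)"
      by (simp add: a)
  next
    fix H assume "H \<in> {P \<in> walks N (Suc i). P 0 = v}"
    then show "(H(Suc i := undefined), H (Suc i)) \<in> ?A \<times> {..<N}"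
      by (auto simp: walks_def atMost_Suc PiE_def Pi_def extensional_def)
  qed simp
  finally show ?case .
qed

definition krylov_gram :: "nat \<Rightarrow> (nat \<times> nat \<Rightarrow> complex) \<Rightarrow> (nat \<Rightarrow> complex) \<Rightarrow> nat \<Rightarrow> nat \<Rightarrow> complex" where
  "krylov_gram N g f i j = (\<Sum>v<N. (apply_mat N g ^^ i) f v * cnj ((apply_mat N g ^^ j) f v))"

definition walk_pairs :: "nat \<Rightarrow> nat \<Rightarrow> nat \<Rightarrow> ((nat \<Rightarrow> nat) \<times> (nat \<Rightarrow> nat)) set" where
  "walk_pairs N i j = {(P, Q) \<in> walks N i \<times> walks N j. P 0 = Q 0}"

lemma finite_walk_pairs [simp]: "finite (walk_pairs N i j)"
  unfolding walk_pairs_def by (rule finite_subset[of _ "walks N i \<times> walks N j"]) auto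

lemma krylov_gram_walks:
  "krylov_gram N g f i j = (\<Sum>(P, Q)\<in>walk_pairs N i j.
     (walk_weight g i P * cnj (walk_weight g j Q)) * (f (P i) * cnj (f (Q j))))"
proof -
  let ?A = "\<lambda>v. {P \<in> walks N i. P 0 = v}" and ?B = "\<lambda>v. {P \<in> walks N j. P 0 = v}"
  let ?h = "\<lambda>(P, Q). (walk_weight g i P * cnj (walk_weight g j Q)) * (f (P i) * cnj (f (Q j)))"
  have "krylov_gram N g f i j = (\<Sum>v<N. \<Sum>x\<in>?A v \<times> ?B v. ?h x)"
    unfolding krylov_gram_def
    by (intro sum.cong refl) (simp add: apply_mat_power_walks cnj_sum sum_product sum.cartesian_product
        case_prod_unfold mult_ac)
  also have "\<dots> = (\<Sum>(v, x)\<in>Sigma {..<N} (\<lambda>v. ?A v \<times> ?B v). ?h x)"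
    by (rule sum.Sigma) auto
  also have "\<dots> = (\<Sum>x\<in>walk_pairs N i j. ?h x)"
    by (rule sum.reindex_bij_witness[where i = "\<lambda>(P, Q). (P 0, (P, Q))" and j = snd])
      (auto simp: walk_pairs_def walks_less)
  finally show ?thesis .
qed

section \<open>Moment bounds for a fixed starting vector\<close>

lemma mset_pair_prod_eq:
  fixes f :: "'a \<Rightarrow> 'b :: comm_monoid_mult"
  assumes "{#a, b#} = {#c, d#}"
  shows "f a * f b = f c * f d"
proof -
  have "f a * f b = prod_mset (image_mset f {#a, b#})" by simp
  also have "\<dots> = f c * f d" unfolding assms by simp
  finally show ?thesis .
qed

text \<open>One term in the expansion of the squared modulus of a Gram entry, with the matrix
  already averaged out and \<open>f\<close> held fixed.\<close>

definition quartic_term :: "nat \<Rightarrow> nat \<Rightarrow> nat \<Rightarrow> (nat \<Rightarrow> complex) \<Rightarrow> (nat \<Rightarrow> nat) \<times> (nat \<Rightarrow> nat)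
    \<Rightarrow> (nat \<Rightarrow> nat) \<times> (nat \<Rightarrow> nat) \<Rightarrow> complex" where
  "quartic_term N i j f = (\<lambda>(P, Q) (P', Q').
     (if edges i P + edges j Q' = edges j Q + edges i P'
      then of_real (edge_moment (edges i P + edges j Q') / real N ^ (i + j)) else 0) *
     (f (P i) * cnj (f (Q j)) * cnj (f (P' i) * cnj (f (Q' j)))))"

lemma norm_sum_quartic_term_le:
  assumes N: "0 < N" and f: "(\<Sum>v<N. (cmod (f v))\<^sup>2) \<le> 1"
  shows "norm (\<Sum>x\<in>walk_pairs N i j. \<Sum>y\<in>walk_pairs N i j. quartic_term N i j f x y)
     \<le> of_bool (i = j) + fact (i + j) * (real i + real j + 2)\<^sup>2 / real N"
proof -
  define w where "w v = (cmod (f v))\<^sup>2" for v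
  let ?S = "\<Sum>v<N. w v"
  let ?A = "walk_pairs N i j" and ?W = "walks N i \<times> walks N j"
  let ?R = "\<lambda>(P, Q'). rearrangements N i j P Q'"
  let ?m = "\<lambda>(P, Q'). edge_moment (edges i P + edges j Q')"
  let ?w = "\<lambda>(P, Q'). w (P i) * w (Q' j)"
  let ?good = "\<lambda>(P, Q'). injective_before_end i j P Q'"
  have S: "0 \<le> ?S" "?S \<le> 1" using f by (auto simp: w_def sum_nonneg)
  then have S2: "?S\<^sup>2 \<le> 1" by (simp add: power_le_one)
  have term0: "norm (quartic_term N i j f (P, Q) (P', Q')) =
      (if edges i P + edges j Q' = edges j Q + edges i P' then ?m (P, Q') / real N ^ (i + j) * ?w (P, Q') else 0)"
    if "P 0 = Q 0" "P' 0 = Q' 0" for P Q P' Q'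
  proof (cases "edges i P + edges j Q' = edges j Q + edges i P'")
    case True
    then have "{#P i, Q' j#} = {#Q j, P' i#}" using that by (rule walk_pair_ends_eq)
    then have ends: "cmod (f (P i)) * cmod (f (Q' j)) = cmod (f (Q j)) * cmod (f (P' i))"
      by (rule mset_pair_prod_eq)
    \<comment> \<open>The weight of \<open>(P, Q')\<close> is the square of a product of two moduli.
      Equality of the end points exchanges one of the two copies for the moduli along
      \<open>Q\<close> and \<open>P'\<close>.\<close>
    have "?w (P, Q') = (cmod (f (P i)) * cmod (f (Q' j))) * (cmod (f (P i)) * cmod (f (Q' j)))"
      by (simp add: w_def power2_eq_square mult_ac)
    also have "\<dots> = (cmod (f (P i)) * cmod (f (Q' j))) * (cmod (f (Q j)) * cmod (f (P' i)))"
      by (simp only: ends)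
    finally have "?w (P, Q') = cmod (f (P i)) * cmod (f (Q j)) * (cmod (f (P' i)) * cmod (f (Q' j)))"
      by (simp add: mult_ac)
    moreover have "norm (of_real (?m (P, Q') / real N ^ (i + j)) :: complex) = ?m (P, Q') / real N ^ (i + j)"
      using edge_moment_ge_1[of "edges i P + edges j Q'"] by (simp add: norm_divide norm_power)
    ultimately show ?thesis
      by (simp only: quartic_term_def prod.case True simp_thms if_True norm_mult complex_mod_cnj)
  qed (simp add: quartic_term_def)
  \<comment> \<open>The Gram expansion groups walks by common starting points, as
    \<open>(P, Q)\<close> and \<open>(P', Q')\<close>. The count needs them grouped by common edges,
    as \<open>(P, Q')\<close> and \<open>(Q, P')\<close>.\<close>
  let ?b = "\<lambda>((P, Q'), (Q, P')). ((P, Q), (P', Q'))" and ?a = "\<lambda>((P, Q), (P', Q')). ((P, Q'), (Q, P'))"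
  let ?ok = "\<lambda>((P, Q), (P', Q')). edges i P + edges j Q' = edges j Q + edges i P'"
  have "norm (\<Sum>x\<in>?A. \<Sum>y\<in>?A. quartic_term N i j f x y)
      \<le> (\<Sum>x\<in>?A. \<Sum>y\<in>?A. norm (quartic_term N i j f x y))"
    by (rule order_trans[OF norm_sum sum_mono[OF norm_sum]])
  also have "\<dots> = (\<Sum>(x, y)\<in>?A \<times> ?A. norm (quartic_term N i j f x y))"
    by (rule sum.cartesian_product)
  also have "\<dots> = (\<Sum>(x, y) | (x, y) \<in> ?A \<times> ?A \<and> ?ok (x, y). norm (quartic_term N i j f x y))"
  proof (rule sum.mono_neutral_right)
    show "\<forall>z\<in>?A \<times> ?A - {(x, y). (x, y) \<in> ?A \<times> ?A \<and> ?ok (x, y)}.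
        (case z of (x, y) \<Rightarrow> norm (quartic_term N i j f x y)) = 0"
      by (auto simp: walk_pairs_def term0 split: if_splits)
  qed auto
  also have "\<dots> = (\<Sum>(z, y)\<in>Sigma ?W ?R. ?m z / real N ^ (i + j) * ?w z)"
  proof (rule sum.reindex_bij_witness[where i = ?b and j = ?a])
    fix z assume "z \<in> {(x, y). (x, y) \<in> ?A \<times> ?A \<and> ?ok (x, y)}"
    moreover obtain P Q P' Q' where z: "z = ((P, Q), (P', Q'))" by (metis surj_pair)
    ultimately have ok: "edges i P + edges j Q' = edges j Q + edges i P'" "P 0 = Q 0" "P' 0 = Q' 0"
      and walks: "P \<in> walks N i" "Q \<in> walks N j" "P' \<in> walks N i" "Q' \<in> walks N j"
      by (simp_all add: walk_pairs_def)
    show "?b (?a z) = z"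
      by (simp add: z)
    show "?a z \<in> Sigma ?W ?R"
      using ok walks by (simp add: z rearrangements_def)
    show "(case ?a z of (z, y) \<Rightarrow> ?m z / real N ^ (i + j) * ?w z) = (case z of (x, y) \<Rightarrow> norm (quartic_term N i j f x y))"
      unfolding z prod.case term0[of P Q P' Q', OF ok(2,3)] if_P[OF ok(1)] ..
  next
    fix z assume "z \<in> Sigma ?W ?R"
    moreover obtain P Q P' Q' where z: "z = ((P, Q'), (Q, P'))" by (metis surj_pair)
    ultimately have ok: "edges i P + edges j Q' = edges j Q + edges i P'" "P 0 = Q 0" "P' 0 = Q' 0"
      and walks: "P \<in> walks N i" "Q \<in> walks N j" "P' \<in> walks N i" "Q' \<in> walks N j"
      by (simp_all add: rearrangements_def)
    show "?a (?b z) = z"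
      by (simp add: z)
    show "?b z \<in> {(x, y). (x, y) \<in> ?A \<times> ?A \<and> ?ok (x, y)}"
      using ok walks by (simp add: z walk_pairs_def)
  qed
  also have "\<dots> = (\<Sum>z\<in>?W. \<Sum>y\<in>?R z. ?m z / real N ^ (i + j) * ?w z)"
  proof (rule sum.Sigma[symmetric])
    have "finite (rearrangements N i j P Q')" for P Q'
      by (rule finite_subset[of _ "walks N j \<times> walks N i"]) (auto simp: rearrangements_def)
    then show "\<forall>z\<in>?W. finite (?R z)" by auto
  qed simp
  also have "\<dots> = (\<Sum>z\<in>?W. (\<Sum>y\<in>?R z. ?m z) * ?w z) / real N ^ (i + j)"
    by (simp only: sum_divide_distrib sum_distrib_right times_divide_eq_left)
  \<comment> \<open>The delta term is charged to the non-injective pairs as well, so that its sum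
    runs over all pairs and factorizes.\<close>
  also have "\<dots> \<le> (\<Sum>z\<in>?W. of_bool (i = j) * ?w z + (if ?good z then 0 else fact (i + j) * ?w z)) / real N ^ (i + j)"
  proof (rule divide_right_mono[OF sum_mono])
    fix z assume "z \<in> ?W"
    then obtain P Q' where z: "z = (P, Q')" "P \<in> walks N i" "Q' \<in> walks N j" by (rule SigmaE)
    have w0: "0 \<le> ?w z" by (simp add: z w_def)
    show "(\<Sum>y\<in>?R z. ?m z) * ?w z \<le> of_bool (i = j) * ?w z + (if ?good z then 0 else fact (i + j) * ?w z)"
    proof (cases "?good z")
      case True
      then have "(\<Sum>y\<in>?R z. ?m z) \<le> of_bool (i = j)"
        unfolding z(1) prod.case by (rule rearrangements_moment_injective[OF _ z(2,3)])
      from mult_right_mono[OF this w0] True show ?thesis by (simp only: if_True add_0_right)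
    next
      case False
      have "(\<Sum>y\<in>?R z. ?m z) \<le> fact (i + j)"
        unfolding z(1) prod.case by (rule rearrangements_moment_le)
      from mult_right_mono[OF this w0] have le: "(\<Sum>y\<in>?R z. ?m z) * ?w z \<le> fact (i + j) * ?w z" .
      have "0 \<le> of_bool (i = j) * ?w z" using w0 by simp
      with le show ?thesis unfolding if_not_P[OF False] by (intro add_increasing)
    qed
  qed simp
  also have "(\<Sum>z\<in>?W. of_bool (i = j) * ?w z + (if ?good z then 0 else fact (i + j) * ?w z))
      = of_bool (i = j) * (\<Sum>z\<in>?W. ?w z) + fact (i + j) * (\<Sum>z | z \<in> ?W \<and> \<not> ?good z. ?w z)"
  proof -
    have "(\<Sum>z\<in>?W. if ?good z then 0 else fact (i + j) * ?w z) = (\<Sum>z | z \<in> ?W \<and> \<not> ?good z. fact (i + j) * ?w z)"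
      by (rule sum.mono_neutral_cong_right) auto
    then show ?thesis by (simp only: sum.distrib sum_distrib_left)
  qed
  also have "(\<Sum>z\<in>?W. ?w z) = real N ^ (i + j) * ?S\<^sup>2"
  proof -
    have "(\<Sum>z\<in>?W. ?w z) = (\<Sum>P\<in>walks N i. w (P i)) * (\<Sum>Q\<in>walks N j. w (Q j))"
      by (simp add: sum_product sum.cartesian_product)
    then show ?thesis by (simp add: sum_walks_end power_add power2_eq_square)
  qed
  also have "(of_bool (i = j) * (real N ^ (i + j) * ?S\<^sup>2) + fact (i + j) * (\<Sum>z | z \<in> ?W \<and> \<not> ?good z. ?w z)) / real N ^ (i + j)
     \<le> of_bool (i = j) + fact (i + j) * (real i + real j + 2)\<^sup>2 / real N"
  proof -
    let ?bad = "\<Sum>z | z \<in> ?W \<and> \<not> ?good z. ?w z"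
    have "{z \<in> ?W. \<not> ?good z} = {(P, Q). (P, Q) \<in> ?W \<and> \<not> injective_before_end i j P Q}"
      by auto
    then have "real N * ?bad \<le> (real i + real j + 2)\<^sup>2 * (real N ^ (i + j) * ?S\<^sup>2)"
      using sum_walk_pairs_not_injective[of w N i j] by (simp add: w_def add_ac)
    also have "\<dots> \<le> (real i + real j + 2)\<^sup>2 * (real N ^ (i + j) * 1)"
      using S2 by (intro mult_left_mono) auto
    finally have "?bad \<le> (real i + real j + 2)\<^sup>2 * real N ^ (i + j) / N"
      using N by (simp add: field_simps)
    then have "fact (i + j) * ?bad \<le> fact (i + j) * ((real i + real j + 2)\<^sup>2 * real N ^ (i + j) / N)"
      by (intro mult_left_mono) auto
    moreover have "of_bool (i = j) * (real N ^ (i + j) * ?S\<^sup>2) \<le> of_bool (i = j) * (real N ^ (i + j) * 1)"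
      using S2 by (intro mult_left_mono) auto
    ultimately have "(of_bool (i = j) * (real N ^ (i + j) * ?S\<^sup>2) + fact (i + j) * ?bad) / real N ^ (i + j)
      \<le> (of_bool (i = j) * real N ^ (i + j) + fact (i + j) * ((real i + real j + 2)\<^sup>2 * real N ^ (i + j) / N)) / real N ^ (i + j)"
      unfolding mult_1_right by (intro divide_right_mono add_mono zero_le_power of_nat_0_le_iff)
    also have "\<dots> = of_bool (i = j) + fact (i + j) * (real i + real j + 2)\<^sup>2 / real N"
      using N by (simp add: add_divide_distrib)
    finally show ?thesis .
  qed
  finally show ?thesis .
qed

text \<open>The first moment of a diagonal Gram entry with \<open>f\<close> fixed. Equal edges and
  equal starts force equal ends, so every term has nonnegative real part and all terms except
  \<open>Q = P\<close> may be dropped. What remains is bounded below because factorials are at least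
  one.\<close>

lemma Re_sum_quadratic_term_ge:
  assumes N: "0 < N"
  shows "(\<Sum>v<N. (cmod (f v))\<^sup>2) \<le> Re (\<Sum>(P, Q)\<in>walk_pairs N i i.
     (if edges i P = edges i Q then of_real (edge_moment (edges i P) / real N ^ i) else 0) * (f (P i) * cnj (f (Q i))))"
proof -
  let ?t = "\<lambda>(P, Q). (if edges i P = edges i Q then of_real (edge_moment (edges i P) / real N ^ i) else 0) * (f (P i) * cnj (f (Q i)))"
  let ?D = "(\<lambda>P. (P, P)) ` walks N i"
  have t: "Re (?t (P, Q)) = (if edges i P = edges i Q then edge_moment (edges i P) / real N ^ i * (cmod (f (P i)))\<^sup>2 else 0)"
    if "P 0 = Q 0" for P Q
  proof (cases "edges i P = edges i Q")
    case True
    from True that have "P i = Q i" by (rule walk_ends_eq[where P = P and Q = Q and i = i])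
    then have "f (P i) * cnj (f (Q i)) = of_real ((cmod (f (P i)))\<^sup>2)"
      by (simp only: complex_norm_square)
    with True show ?thesis
      by (simp only: prod.case simp_thms if_True of_real_mult[symmetric] Re_complex_of_real)
  qed simp
  have "(\<Sum>v<N. (cmod (f v))\<^sup>2) = (\<Sum>P\<in>walks N i. (cmod (f (P i)))\<^sup>2) / real N ^ i"
    using N by (subst sum_walks_end) simp
  also have "\<dots> \<le> (\<Sum>P\<in>walks N i. edge_moment (edges i P) / real N ^ i * (cmod (f (P i)))\<^sup>2)"
    unfolding sum_divide_distrib
  proof (rule sum_mono)
    fix P
    show "(cmod (f (P i)))\<^sup>2 / real N ^ i \<le> edge_moment (edges i P) / real N ^ i * (cmod (f (P i)))\<^sup>2"
      using mult_right_mono[OF edge_moment_ge_1[of "edges i P"], of "(cmod (f (P i)))\<^sup>2 / real N ^ i"] by simp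
  qed
  also have "\<dots> = (\<Sum>P\<in>walks N i. Re (?t (P, P)))"
    by (simp only: t simp_thms if_True)
  also have "\<dots> = (\<Sum>x\<in>?D. Re (?t x))"
    by (subst sum.reindex) (simp_all add: inj_on_def)
  also have "\<dots> \<le> (\<Sum>x\<in>walk_pairs N i i. Re (?t x))"
  proof (rule sum_mono2)
    fix x assume "x \<in> walk_pairs N i i - ?D"
    then obtain P Q where x: "x = (P, Q)" "P 0 = Q 0" by (auto simp: walk_pairs_def)
    have "0 \<le> edge_moment (edges i P) / real N ^ i * (cmod (f (P i)))\<^sup>2"
      using edge_moment_ge_1[of "edges i P"] by simp
    then show "0 \<le> Re (?t x)"
      unfolding x(1) t[of P Q, OF x(2)] by (subst if_split) (intro conjI impI order_refl)
  qed (rule finite_walk_pairs, auto simp: walk_pairs_def)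
  also have "\<dots> = Re (\<Sum>x\<in>walk_pairs N i i. ?t x)" by simp
  finally show ?thesis .
qed

section \<open>Least squares by successive projection\<close>

abbreviation vnorm :: "nat \<Rightarrow> (nat \<Rightarrow> complex) \<Rightarrow> real" where
  "vnorm N f \<equiv> L2_set (\<lambda>v. cmod (f v)) {..<N}"

definition ip :: "nat \<Rightarrow> (nat \<Rightarrow> complex) \<Rightarrow> (nat \<Rightarrow> complex) \<Rightarrow> complex" where
  "ip N f g = (\<Sum>v<N. f v * cnj (g v))"

definition reject :: "nat \<Rightarrow> (nat \<Rightarrow> complex) \<Rightarrow> (nat \<Rightarrow> complex) \<Rightarrow> nat \<Rightarrow> complex" where
  "reject N w f = (\<lambda>v. f v - ip N f w / ip N w w * w v)"

lemma vnorm_cong: "(\<And>v. v < N \<Longrightarrow> f v = g v) \<Longrightarrow> vnorm N f = vnorm N g"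
  by (simp add: L2_set_def)

lemma vnorm_square: "(vnorm N f)\<^sup>2 = (\<Sum>v<N. (cmod (f v))\<^sup>2)"
  by (simp add: L2_set_def sum_nonneg)

lemma ip_self: "ip N f f = of_real ((vnorm N f)\<^sup>2)"
  unfolding ip_def vnorm_square by (simp only: of_real_sum complex_norm_square)

lemma ip_reject: "ip N (reject N w f) w = 0"
proof (cases "ip N w w = 0")
  case True
  then have "vnorm N w = 0" by (simp add: ip_self)
  then have "w v = 0" if "v < N" for v
    using that by (simp add: L2_set_eq_0_iff)
  then show ?thesis by (simp add: ip_def)
next
  case False
  have "ip N (reject N w f) w = ip N f w - ip N f w / ip N w w * ip N w w"
    by (simp add: ip_def reject_def left_diff_distrib sum_subtractf sum_distrib_left mult.assoc)
  with False show ?thesis by simp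
qed

lemma vnorm_pythagoras:
  assumes "ip N g w = 0"
  shows "(vnorm N (\<lambda>v. g v + d * w v))\<^sup>2 = (vnorm N g)\<^sup>2 + (cmod d)\<^sup>2 * (vnorm N w)\<^sup>2"
proof -
  have "complex_of_real ((vnorm N (\<lambda>v. g v + d * w v))\<^sup>2)
      = ip N g g + d * cnj d * ip N w w + cnj d * ip N g w + d * cnj (ip N g w)"
    unfolding ip_self[symmetric]
    by (simp add: ip_def algebra_simps sum.distrib sum_distrib_left cnj_sum)
  also have "\<dots> = complex_of_real ((vnorm N g)\<^sup>2 + (cmod d)\<^sup>2 * (vnorm N w)\<^sup>2)"
    using assms by (simp add: ip_self complex_norm_square[symmetric])
  finally show ?thesis by (simp only: of_real_eq_iff)
qed

text \<open>The vector on the right differs from the rejection by a multiple of \<open>w\<close>, to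
  which the rejection is orthogonal.\<close>

lemma vnorm_reject_le: "vnorm N (reject N w f) \<le> vnorm N (\<lambda>v. f v + c * w v)"
proof -
  have "(vnorm N (\<lambda>v. f v + c * w v))\<^sup>2
      = (vnorm N (\<lambda>v. reject N w f v + (c + ip N f w / ip N w w) * w v))\<^sup>2"
    by (simp add: reject_def algebra_simps)
  also have "\<dots> \<ge> (vnorm N (reject N w f))\<^sup>2"
    by (subst vnorm_pythagoras[OF ip_reject]) simp
  finally show ?thesis by (rule power2_le_imp_le) (simp add: L2_set_nonneg)
qed

text \<open>This allows \<open>V k\<close> to be projected out of all vectors before the remaining
  coefficients are chosen.\<close>

lemma reject_linear:
  "reject N w (\<lambda>v. f v + (\<Sum>m<k. c m * V m v))
    = (\<lambda>v. reject N w f v + (\<Sum>m<k. c m * reject N w (V m) v))"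
proof -
  have ip: "ip N (\<lambda>v. f v + (\<Sum>m<k. c m * V m v)) w = ip N f w + (\<Sum>m<k. c m * ip N (V m) w)"
  proof -
    have "(\<Sum>v<N. (\<Sum>m<k. c m * V m v) * cnj (w v)) = (\<Sum>m<k. \<Sum>v<N. c m * V m v * cnj (w v))"
      unfolding sum_distrib_right by (rule sum.swap)
    then show ?thesis
      by (simp add: ip_def distrib_right sum.distrib sum_distrib_left mult.assoc)
  qed
  show ?thesis
  proof
    fix v
    have "(\<Sum>m<k. c m * ip N (V m) w) / ip N w w * w v = (\<Sum>m<k. c m * (ip N (V m) w / ip N w w * w v))"
      by (simp add: sum_divide_distrib sum_distrib_right mult.assoc)
    then show "reject N w (\<lambda>v. f v + (\<Sum>m<k. c m * V m v)) v
      = reject N w f v + (\<Sum>m<k. c m * reject N w (V m) v)"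
      unfolding reject_def ip by (simp add: add_divide_distrib distrib_right right_diff_distrib sum_subtractf)
  qed
qed

text \<open>Since \<open>x / 0 = 0\<close>, \<open>reject N w\<close> is the orthogonal projection also when \<open>w\<close> vanishes, so that
  no linear independence is needed below.\<close>

fun lsq_dist :: "nat \<Rightarrow> nat \<Rightarrow> (nat \<Rightarrow> complex) \<Rightarrow> (nat \<Rightarrow> nat \<Rightarrow> complex) \<Rightarrow> real" where
  "lsq_dist N 0 f V = vnorm N f"
| "lsq_dist N (Suc k) f V = lsq_dist N k (reject N (V k) f) (\<lambda>m. reject N (V k) (V m))"

lemma lsq_dist_attained:
  "\<exists>c. lsq_dist N k f V = vnorm N (\<lambda>v. f v + (\<Sum>m<k. c m * V m v))"
proof (induction k arbitrary: f V)
  case (Suc k)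
  let ?w = "V k"
  from Suc.IH[of "reject N ?w f" "\<lambda>m. reject N ?w (V m)"] obtain c where
    c: "lsq_dist N (Suc k) f V = vnorm N (\<lambda>v. reject N ?w f v + (\<Sum>m<k. c m * reject N ?w (V m) v))"
    by auto
  define h where "h = (\<lambda>v. f v + (\<Sum>m<k. c m * V m v))"
  \<comment> \<open>The new coefficient turns the combination \<open>h\<close> into its rejection;
    updating at \<open>k\<close> leaves the coefficients below \<open>k\<close> unchanged.\<close>
  define c' where "c' = c(k := - ip N h ?w / ip N ?w ?w)"
  have "reject N ?w h = (\<lambda>v. f v + (\<Sum>m<Suc k. c' m * V m v))"
    by (simp add: reject_def fun_eq_iff c'_def) (simp add: h_def)
  moreover have "lsq_dist N (Suc k) f V = vnorm N (reject N ?w h)"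
    unfolding h_def reject_linear by (rule c)
  ultimately show ?case by (intro exI[of _ c']) (simp only:)
qed simp

lemma lsq_dist_le: "lsq_dist N k f V \<le> vnorm N (\<lambda>v. f v + (\<Sum>m<k. c m * V m v))"
proof (induction k arbitrary: f V)
  case (Suc k)
  let ?w = "V k"
  have "lsq_dist N (Suc k) f V \<le> vnorm N (reject N ?w (\<lambda>v. f v + (\<Sum>m<k. c m * V m v)))"
    unfolding reject_linear using Suc.IH by simp
  also have "\<dots> \<le> vnorm N (\<lambda>v. f v + (\<Sum>m<k. c m * V m v) + c k * ?w v)"
    by (rule vnorm_reject_le)
  finally show ?case by (simp add: add.assoc)
qed simp

section \<open>Measurability of the least squares distance\<close>

lemma borel_measurable_cnj:
  assumes "f \<in> borel_measurable M"
  shows "(\<lambda>x. cnj (f x)) \<in> borel_measurable M"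
  using assms by (rule measurable_compose) (intro borel_measurable_continuous_onI continuous_intros)

text \<open>The purpose of the recursion: a minimum over a continuum of coefficients is not visibly
  measurable, whereas \<open>lsq_dist\<close> is built from finitely many arithmetic operations and
  a norm.\<close>

lemma borel_measurable_lsq_dist:
  assumes "\<And>v. v < N \<Longrightarrow> (\<lambda>\<omega>. f \<omega> v) \<in> borel_measurable M"
    and "\<And>m v. v < N \<Longrightarrow> (\<lambda>\<omega>. V \<omega> m v) \<in> borel_measurable M"
  shows "(\<lambda>\<omega>. lsq_dist N k (f \<omega>) (V \<omega>)) \<in> borel_measurable M"
  using assms
proof (induction k arbitrary: f V)
  case 0
  then show ?case unfolding lsq_dist.simps L2_set_def
    by (intro measurable_compose[OF _ borel_measurable_sqrt] borel_measurable_sum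
        borel_measurable_power borel_measurable_norm) auto
next
  case (Suc k)
  have ip: "(\<lambda>\<omega>. ip N (g \<omega>) (h \<omega>)) \<in> borel_measurable M"
    if "\<And>v. v < N \<Longrightarrow> (\<lambda>\<omega>. g \<omega> v) \<in> borel_measurable M" "\<And>v. v < N \<Longrightarrow> (\<lambda>\<omega>. h \<omega> v) \<in> borel_measurable M"
    for g h
    unfolding ip_def using that by (intro borel_measurable_sum borel_measurable_times borel_measurable_cnj) auto
  have "(\<lambda>\<omega>. reject N (V \<omega> k) (g \<omega>) v) \<in> borel_measurable M"
    if "\<And>v. v < N \<Longrightarrow> (\<lambda>\<omega>. g \<omega> v) \<in> borel_measurable M" "v < N" for g v
    unfolding reject_def using that Suc.prems
    by (intro borel_measurable_diff borel_measurable_times borel_measurable_divide ip) auto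
  then show ?case unfolding lsq_dist.simps using Suc.prems by (intro Suc.IH) auto
qed

lemma apply_mat_cong:
  assumes "\<And>v u. v < N \<Longrightarrow> u < N \<Longrightarrow> g (v, u) = g' (v, u)"
    and "\<And>v. v < N \<Longrightarrow> f v = f' v" and "v < N"
  shows "(apply_mat N g ^^ m) f v = (apply_mat N g' ^^ m) f' v"
  using assms(2,3)
proof (induction m arbitrary: v)
  case (Suc m)
  then show ?case using assms(1) by (simp add: apply_mat_def)
qed simp

section \<open>Polynomials in a matrix and the GMRES residual\<close>

definition apply_poly :: "nat \<Rightarrow> (nat \<times> nat \<Rightarrow> complex) \<Rightarrow> complex poly \<Rightarrow> (nat \<Rightarrow> complex) \<Rightarrow> nat \<Rightarrow> complex" where
  "apply_poly N g p f v = (\<Sum>m\<le>degree p. coeff p m * (apply_mat N g ^^ m) f v)"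

lemma apply_poly_degree_le:
  assumes "degree p \<le> n"
  shows "apply_poly N g p f v = (\<Sum>m\<le>n. coeff p m * (apply_mat N g ^^ m) f v)"
  unfolding apply_poly_def using assms by (intro sum.mono_neutral_left) (auto simp: coeff_eq_0)

lemma apply_mat_apply_poly:
  "apply_mat N g (apply_poly N g p f) v = (\<Sum>m\<le>degree p. coeff p m * (apply_mat N g ^^ Suc m) f v)"
proof -
  have "apply_mat N g (apply_poly N g p f) v
      = (\<Sum>u<N. \<Sum>m\<le>degree p. coeff p m * (g (v, u) * (apply_mat N g ^^ m) f u))"
    by (simp add: apply_mat_def apply_poly_def sum_distrib_left mult_ac)
  also have "\<dots> = (\<Sum>m\<le>degree p. \<Sum>u<N. coeff p m * (g (v, u) * (apply_mat N g ^^ m) f u))"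
    by (rule sum.swap)
  finally show ?thesis by (simp add: apply_mat_def sum_distrib_left)
qed

lemma apply_poly_pCons:
  "apply_poly N g (pCons a p) f v = a * f v + apply_mat N g (apply_poly N g p f) v"
proof -
  have "apply_poly N g (pCons a p) f v
      = (\<Sum>m\<le>Suc (degree p). coeff (pCons a p) m * (apply_mat N g ^^ m) f v)"
    by (rule apply_poly_degree_le) (simp add: degree_pCons_le)
  also have "\<dots> = a * f v + (\<Sum>m\<le>degree p. coeff p m * (apply_mat N g ^^ Suc m) f v)"
    unfolding sum.atMost_Suc_shift by simp
  finally show ?thesis unfolding apply_mat_apply_poly .
qed

lemma apply_poly_add: "apply_poly N g (p + q) f v = apply_poly N g p f v + apply_poly N g q f v"
proof -
  let ?n = "max (degree p) (degree q)"
  show ?thesis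
    using apply_poly_degree_le[of p ?n] apply_poly_degree_le[of q ?n]
      apply_poly_degree_le[of "p + q" ?n] degree_add_le_max[of p q]
    by (simp add: distrib_right sum.distrib)
qed

lemma apply_poly_smult: "apply_poly N g (Polynomial.smult c p) f v = c * apply_poly N g p f v"
  using apply_poly_degree_le[of "Polynomial.smult c p" "degree p"]
  by (simp add: apply_poly_def sum_distrib_left mult.assoc degree_smult_le)

text \<open>Here \<open>h\<close> is the identity plus \<open>s\<close> times \<open>g\<close> on
  the indices below \<open>N\<close>. Both sides obey the same Horner recursion in
  \<open>p\<close>.\<close>

lemma apply_poly_pcompose:
  assumes h: "\<And>v u. v < N \<Longrightarrow> u < N \<Longrightarrow> h (v, u) = of_bool (v = u) + s * g (v, u)"
  shows "v < N \<Longrightarrow> apply_poly N h p f v = apply_poly N g (pcompose p [:1, s:]) f v"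
proof (induction p arbitrary: v)
  case 0
  show ?case by (simp add: apply_poly_def)
next
  case (pCons a p)
  let ?r = "pcompose p [:1, s:]"
  let ?e = "apply_poly N g ?r f"
  have "apply_poly N h (pCons a p) f v = a * f v + apply_mat N h ?e v"
    using pCons by (simp add: apply_poly_pCons apply_mat_def)
  also have "apply_mat N h ?e v = (\<Sum>u<N. (if v = u then ?e u else 0) + s * (g (v, u) * ?e u))"
    unfolding apply_mat_def using pCons.prems h by (intro sum.cong refl) (auto simp: algebra_simps)
  also have "\<dots> = ?e v + s * apply_mat N g ?e v"
    using pCons.prems by (simp add: sum.distrib apply_mat_def sum_distrib_left)
  also have "a * f v + (?e v + s * apply_mat N g ?e v) = apply_poly N g (pcompose (pCons a p) [:1, s:]) f v"
  proof -
    have "pcompose (pCons a p) [:1, s:] = [:a:] + (?r + pCons 0 (Polynomial.smult s ?r))"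
      by (simp add: pcompose_pCons)
    moreover have "apply_mat N g (apply_poly N g (Polynomial.smult s ?r) f) v = s * apply_mat N g ?e v"
      by (simp add: apply_mat_def apply_poly_smult sum_distrib_left mult_ac)
    moreover have "apply_poly N g [:a:] f v = a * f v" by (simp add: apply_poly_def)
    ultimately show ?thesis by (simp add: apply_poly_add apply_poly_pCons)
  qed
  finally show ?case .
qed

lemma pow_mat_vec:
  assumes A: "A \<in> carrier_mat N N" and "b \<in> carrier_vec N" "i < N"
  shows "((A ^\<^sub>m m) *\<^sub>v b) $ i = (apply_mat N (($$) A) ^^ m) (\<lambda>i. b $ i) i"
  using assms(2,3)
proof (induction m arbitrary: b i)
  case 0
  then show ?case using A by simp
next
  case (Suc m)
  have "(A ^\<^sub>m Suc m) *\<^sub>v b = (A ^\<^sub>m m) *\<^sub>v (A *\<^sub>v b)"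
    using A Suc.prems by (simp add: assoc_mult_mat_vec[of _ N N _ N])
  also have "\<dots> $ i = (apply_mat N (($$) A) ^^ m) (\<lambda>i. (A *\<^sub>v b) $ i) i"
    using A Suc by simp
  also have "\<dots> = (apply_mat N (($$) A) ^^ m) (apply_mat N (($$) A) (\<lambda>i. b $ i)) i"
    using A Suc.prems
    by (intro apply_mat_cong) (auto simp: apply_mat_def scalar_prod_def atLeast0LessThan)
  finally show ?case by (simp add: funpow_swap1)
qed

lemma poly_mat_vec:
  assumes A: "A \<in> carrier_mat N N" and b: "b \<in> carrier_vec N" and i: "i < N"
  shows "(poly_mat p A *\<^sub>v b) $ i = apply_poly N (($$) A) p (\<lambda>i. b $ i) i"
proof -
  have "(poly_mat p A *\<^sub>v b) $ i = (\<Sum>j<N. \<Sum>m\<le>degree p. coeff p m * ((A ^\<^sub>m m) $$ (i, j) * b $ j))"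
    using A b i by (simp add: poly_mat_def scalar_prod_def atLeast0LessThan sum_distrib_right mult.assoc)
  also have "\<dots> = (\<Sum>m\<le>degree p. \<Sum>j<N. coeff p m * ((A ^\<^sub>m m) $$ (i, j) * b $ j))"
    by (rule sum.swap)
  also have "\<dots> = (\<Sum>m\<le>degree p. coeff p m * ((A ^\<^sub>m m) *\<^sub>v b) $ i)"
  proof (intro sum.cong refl)
    fix m
    have "A ^\<^sub>m m \<in> carrier_mat N N" using A by simp
    then have "dim_row (A ^\<^sub>m m) = N" "dim_col (A ^\<^sub>m m) = N" by (simp_all only: carrier_matD)
    then show "(\<Sum>j<N. coeff p m * ((A ^\<^sub>m m) $$ (i, j) * b $ j)) = coeff p m * ((A ^\<^sub>m m) *\<^sub>v b) $ i"
      using b i by (simp add: scalar_prod_def atLeast0LessThan sum_distrib_left)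
  qed
  finally show ?thesis unfolding apply_poly_def using pow_mat_vec[OF A b i] by simp
qed

lemma vec_norm2_poly_mat:
  assumes "A \<in> carrier_mat N N" "b \<in> carrier_vec N"
  shows "vec_norm2 (poly_mat p A *\<^sub>v b) = vnorm N (apply_poly N (($$) A) p (\<lambda>i. b $ i))"
proof -
  have "dim_vec (poly_mat p A *\<^sub>v b) = N" using assms by (simp add: poly_mat_def)
  then show ?thesis
    unfolding vec_norm2_def by (intro L2_set_cong) (simp_all only: poly_mat_vec[OF assms] lessThan_iff)
qed

lemma apply_poly_constant_one:
  assumes "degree p \<le> k" "poly p 0 = 1"
  shows "apply_poly N g p f v = f v + (\<Sum>m<k. coeff p (Suc m) * (apply_mat N g ^^ Suc m) f v)"
proof -
  have "apply_poly N g p f v = (\<Sum>m<Suc k. coeff p m * (apply_mat N g ^^ m) f v)"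
    using assms(1) by (simp only: apply_poly_degree_le lessThan_Suc_atMost)
  also have "\<dots> = coeff p 0 * f v + (\<Sum>m<k. coeff p (Suc m) * (apply_mat N g ^^ Suc m) f v)"
    by (simp only: sum.lessThan_Suc_shift funpow.simps(1) id_apply)
  finally show ?thesis using assms(2) by (simp add: poly_0_coeff_0)
qed

lemma poly_eq_sum_degree_le:
  fixes x :: "'a :: comm_semiring_1"
  assumes "degree p \<le> n"
  shows "poly p x = (\<Sum>m\<le>n. coeff p m * x ^ m)"
  unfolding poly_altdef using assms by (intro sum.mono_neutral_left) (auto simp: coeff_eq_0)

lemma coeff_sum_monom: "coeff (\<Sum>m\<le>k. monom (c m) m) i = (if i \<le> k then c i else 0)"
  by (simp add: coeff_sum)

lemma degree_sum_monom_le: "degree (\<Sum>m\<le>k. monom (c m) m) \<le> k"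
  by (rule degree_sum_le) (auto intro: order_trans[OF degree_monom_le])

section \<open>The residual norm as a least squares distance\<close>

context
  fixes N :: nat and A :: "complex mat" and b :: "complex vec"
  assumes A: "A \<in> carrier_mat N N" and b: "b \<in> carrier_vec N"
begin

private abbreviation (input) "T \<equiv> apply_mat N (($$) A)"

text \<open>Apart from the constant coefficient one, the coefficients of \<open>p\<close> are free,
  so the problem is the distance of \<open>b\<close> from the span of its images under the first
  \<open>k\<close> powers of \<open>A\<close>. As \<open>lsq_dist\<close> is both a lower bound and
  attained, \<open>LEAST\<close> denotes a true minimum.\<close>

lemma gmres_residual_norm_eq_lsq_dist:
    "gmres_residual_norm k A b = lsq_dist N k (($) b) (\<lambda>m. (T ^^ Suc m) (($) b))" (is "_ = ?d")
  and gmres_residual_norm_le: "degree p \<le> k \<Longrightarrow> poly p 0 = 1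
    \<Longrightarrow> gmres_residual_norm k A b \<le> vnorm N (apply_poly N (($$) A) p (($) b))"
  and gmres_residual_norm_attained: "\<exists>p. degree p \<le> k \<and> poly p 0 = 1
    \<and> gmres_residual_norm k A b = vnorm N (apply_poly N (($$) A) p (($) b))"
proof -
  have le: "?d \<le> vnorm N (apply_poly N (($$) A) p (($) b))" if "degree p \<le> k" "poly p 0 = 1" for p
    using lsq_dist_le[of N k "($) b" "\<lambda>m. (T ^^ Suc m) (($) b)" "\<lambda>m. coeff p (Suc m)"]
    by (simp only: apply_poly_constant_one[OF that])
  obtain c where c: "?d = vnorm N (\<lambda>v. b $ v + (\<Sum>m<k. c m * (T ^^ Suc m) (($) b) v))"
    using lsq_dist_attained by blast
  \<comment> \<open>The family starts with the first power of the matrix, hence the shift by one in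
    \<open>c\<close>.\<close>
  define p where "p = (\<Sum>m\<le>k. monom (if m = 0 then 1 else c (m - 1)) m)"
  have p: "degree p \<le> k" "poly p 0 = 1"
    unfolding p_def by (rule degree_sum_monom_le) (simp add: poly_0_coeff_0 coeff_sum_monom)
  have eq: "?d = vnorm N (apply_poly N (($$) A) p (($) b))"
    unfolding c apply_poly_constant_one[OF p] by (simp add: p_def coeff_sum_monom)
  show d: "gmres_residual_norm k A b = ?d"
    unfolding gmres_residual_norm_def vec_norm2_poly_mat[OF A b]
    by (rule Least_equality) (use le eq p in auto)
  show "degree p \<le> k \<Longrightarrow> poly p 0 = 1
      \<Longrightarrow> gmres_residual_norm k A b \<le> vnorm N (apply_poly N (($$) A) p (($) b))" for p
    unfolding d by (rule le)
  show "\<exists>p. degree p \<le> k \<and> poly p 0 = 1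
      \<and> gmres_residual_norm k A b = vnorm N (apply_poly N (($$) A) p (($) b))"
    unfolding d using p eq by blast
qed

end

text \<open>The substitution \<open>p(1 + \<sigma>z) = q(z)\<close> turns the normalization \<open>p(0) = 1\<close> into \<open>q(-1/\<sigma>) = 1\<close>.\<close>

context
  fixes N :: nat and G :: "complex mat" and b :: "complex vec" and \<sigma> :: real
  assumes G: "G \<in> carrier_mat N N" and b: "b \<in> carrier_vec N" and \<sigma>: "0 < \<sigma>"
begin

private abbreviation (input) "A \<equiv> 1\<^sub>m N + complex_of_real \<sigma> \<cdot>\<^sub>m G"
private abbreviation (input) "krylov_norm k c \<equiv> vnorm N (\<lambda>v. \<Sum>m\<le>k. c m * (apply_mat N (($$) G) ^^ m) (($) b) v)"

lemma gmres_shifted_attained: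
  "\<exists>c. (\<Sum>m\<le>k. c m * complex_of_real (- 1 / \<sigma>) ^ m) = 1 \<and> gmres_residual_norm k A b = krylov_norm k c"
proof -
  have A: "A \<in> carrier_mat N N" using G by simp
  obtain p where p: "degree p \<le> k" "poly p 0 = 1"
    "gmres_residual_norm k A b = vnorm N (apply_poly N (($$) A) p (($) b))"
    using gmres_residual_norm_attained[OF A b] by blast
  let ?q = "pcompose p [:1, complex_of_real \<sigma>:]"
  have deg: "degree ?q \<le> k" using p(1) by (simp add: degree_pcompose)
  have "poly ?q (complex_of_real (- 1 / \<sigma>)) = 1"
    using p(2) \<sigma> by (simp add: poly_pcompose)
  then have "(\<Sum>m\<le>k. coeff ?q m * complex_of_real (- 1 / \<sigma>) ^ m) = 1"
    using poly_eq_sum_degree_le[OF deg] by simp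
  moreover have "gmres_residual_norm k A b = krylov_norm k (coeff ?q)"
    unfolding p(3)
  proof (rule vnorm_cong)
    fix v assume "v < N"
    then have "apply_poly N (($$) A) p (($) b) v = apply_poly N (($$) G) ?q (($) b) v"
      using G by (intro apply_poly_pcompose) auto
    then show "apply_poly N (($$) A) p (($) b) v
        = (\<Sum>m\<le>k. coeff ?q m * (apply_mat N (($$) G) ^^ m) (($) b) v)"
      by (simp only: apply_poly_degree_le[OF deg])
  qed
  ultimately show ?thesis by blast
qed

lemma gmres_shifted_le:
  assumes c: "(\<Sum>m\<le>k. c m * complex_of_real (- 1 / \<sigma>) ^ m) = 1"
  shows "gmres_residual_norm k A b \<le> krylov_norm k c"
proof -
  have A: "A \<in> carrier_mat N N" using G by simp
  define q where "q = (\<Sum>m\<le>k. monom (c m) m)"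
  \<comment> \<open>The inverse substitution: \<open>?p\<close> at z is \<open>q\<close> at (z - 1)
    / \<open>\<sigma>\<close>.\<close>
  let ?p = "pcompose q [:complex_of_real (- 1 / \<sigma>), complex_of_real (1 / \<sigma>):]"
  have deg: "degree q \<le> k" unfolding q_def by (rule degree_sum_monom_le)
  then have p: "degree ?p \<le> k" by (simp add: degree_pcompose)
  have p0: "poly ?p 0 = 1"
    using c poly_eq_sum_degree_le[OF deg] by (simp add: poly_pcompose q_def coeff_sum_monom)
  have "pcompose ?p [:1, complex_of_real \<sigma>:] = q"
    using \<sigma> by (simp add: pcompose_assoc[symmetric] pcompose_pCons)
  then have eq: "vnorm N (apply_poly N (($$) A) ?p (($) b)) = vnorm N (apply_poly N (($$) G) q (($) b))"
    using G apply_poly_pcompose[of N "($$) A" "complex_of_real \<sigma>" "($$) G" _ ?p "($) b"]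
    by (intro vnorm_cong) auto
  have "gmres_residual_norm k A b \<le> vnorm N (apply_poly N (($$) A) ?p (($) b))"
    by (rule gmres_residual_norm_le[OF A b p p0])
  also have "\<dots> = krylov_norm k c"
    unfolding eq apply_poly_degree_le[OF deg] by (simp add: q_def coeff_sum_monom)
  finally show ?thesis .
qed

end

section \<open>Stability of the minimum under a small Gram error\<close>

lemma vnorm_krylov_combination:
  "complex_of_real ((vnorm N (\<lambda>v. \<Sum>m\<le>k. c m * (apply_mat N g ^^ m) f v))\<^sup>2)
    = (\<Sum>m\<le>k. \<Sum>l\<le>k. c m * cnj (c l) * krylov_gram N g f m l)"
proof -
  let ?t = "\<lambda>m v. (apply_mat N g ^^ m) f v"
  have "complex_of_real ((vnorm N (\<lambda>v. \<Sum>m\<le>k. c m * ?t m v))\<^sup>2)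
      = (\<Sum>v<N. \<Sum>m\<le>k. \<Sum>l\<le>k. c m * cnj (c l) * (?t m v * cnj (?t l v)))"
    unfolding ip_self[symmetric] ip_def by (simp add: cnj_sum sum_product mult_ac)
  also have "\<dots> = (\<Sum>m\<le>k. \<Sum>v<N. \<Sum>l\<le>k. c m * cnj (c l) * (?t m v * cnj (?t l v)))"
    by (rule sum.swap)
  also have "\<dots> = (\<Sum>m\<le>k. \<Sum>l\<le>k. \<Sum>v<N. c m * cnj (c l) * (?t m v * cnj (?t l v)))"
    by (intro sum.cong refl sum.swap)
  finally show ?thesis by (simp add: krylov_gram_def sum_distrib_left)
qed

text \<open>The factor \<open>Suc k\<close> is Cauchy-Schwarz, from the squared sum of moduli to the
  sum of squares. The error is relative to that sum, so it is usable for the unknown minimizing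
  coefficients without an a priori bound on them.\<close>

lemma vnorm_krylov_combination_near:
  assumes gram: "\<And>m l. m \<le> k \<Longrightarrow> l \<le> k \<Longrightarrow> cmod (krylov_gram N g f m l - of_bool (m = l)) \<le> \<eta>"
  shows "\<bar>(vnorm N (\<lambda>v. \<Sum>m\<le>k. c m * (apply_mat N g ^^ m) f v))\<^sup>2 - (\<Sum>m\<le>k. (cmod (c m))\<^sup>2)\<bar>
     \<le> real (Suc k) * \<eta> * (\<Sum>m\<le>k. (cmod (c m))\<^sup>2)"
proof -
  let ?K = "krylov_gram N g f" and ?n = "vnorm N (\<lambda>v. \<Sum>m\<le>k. c m * (apply_mat N g ^^ m) f v)"
  have \<eta>: "0 \<le> \<eta>" using order_trans[OF norm_ge_zero gram[of 0 0]] by simp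
  have "complex_of_real (?n\<^sup>2 - (\<Sum>m\<le>k. (cmod (c m))\<^sup>2))
      = (\<Sum>m\<le>k. \<Sum>l\<le>k. c m * cnj (c l) * ?K m l) - (\<Sum>m\<le>k. c m * cnj (c m))"
    by (simp only: of_real_diff vnorm_krylov_combination of_real_sum complex_norm_square)
  also have "(\<Sum>m\<le>k. c m * cnj (c m)) = (\<Sum>m\<le>k. \<Sum>l\<le>k. c m * cnj (c l) * of_bool (m = l))"
    by (intro sum.cong refl) (simp add: of_bool_def if_distrib cong: if_cong)
  also have "(\<Sum>m\<le>k. \<Sum>l\<le>k. c m * cnj (c l) * ?K m l) - \<dots>
      = (\<Sum>m\<le>k. \<Sum>l\<le>k. c m * cnj (c l) * (?K m l - of_bool (m = l)))"
    by (simp add: sum_subtractf right_diff_distrib)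
  finally have "\<bar>?n\<^sup>2 - (\<Sum>m\<le>k. (cmod (c m))\<^sup>2)\<bar>
      = cmod (\<Sum>m\<le>k. \<Sum>l\<le>k. c m * cnj (c l) * (?K m l - of_bool (m = l)))"
    by (subst (asm) eq_commute) (simp only: norm_of_real)
  also have "\<dots> \<le> (\<Sum>m\<le>k. \<Sum>l\<le>k. cmod (c m * cnj (c l) * (?K m l - of_bool (m = l))))"
    by (rule order_trans[OF norm_sum sum_mono[OF norm_sum]])
  also have "\<dots> \<le> (\<Sum>m\<le>k. \<Sum>l\<le>k. cmod (c m) * cmod (c l) * \<eta>)"
  proof (intro sum_mono)
    fix m l assume "m \<in> {..k}" "l \<in> {..k}"
    then show "cmod (c m * cnj (c l) * (?K m l - of_bool (m = l))) \<le> cmod (c m) * cmod (c l) * \<eta>"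
      unfolding norm_mult complex_mod_cnj by (intro mult_left_mono gram) simp_all
  qed
  also have "\<dots> = \<eta> * (\<Sum>m\<le>k. cmod (c m))\<^sup>2"
    by (simp add: power2_eq_square sum_product sum_distrib_left mult_ac)
  also have "\<dots> \<le> \<eta> * ((\<Sum>m\<le>k. (cmod (c m))\<^sup>2) * real (card {..k}))"
    using \<eta> by (intro mult_left_mono sum_squared_le_sum_of_squares) auto
  finally show ?thesis by (simp add: mult_ac)
qed

definition gmres_limit :: "real \<Rightarrow> nat \<Rightarrow> real" where
  "gmres_limit \<sigma> k = sqrt ((1 - \<sigma>\<^sup>2) / (1 - \<sigma> ^ (2 + 2 * k))) * \<sigma> ^ k"

text \<open>Identifies the closed form of the limit with the minimum of the limiting quadratic
  problem, by the geometric sum with ratio \<open>1 / \<sigma>\<^sup>2\<close>.\<close>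

lemma gmres_limit_square:
  assumes "0 < \<sigma>" "\<sigma> < 1"
  shows "(gmres_limit \<sigma> k)\<^sup>2 * (\<Sum>m\<le>k. (1 / \<sigma>\<^sup>2) ^ m) = 1" and "0 < gmres_limit \<sigma> k"
proof -
  have s2: "0 < \<sigma>\<^sup>2" "\<sigma>\<^sup>2 < 1" using assms by (auto simp: power_less_one_iff)
  have pk: "\<sigma> ^ (2 + 2 * k) < 1" using assms by (subst power_less_one_iff) auto
  have q: "0 < (1 - \<sigma>\<^sup>2) / (1 - \<sigma> ^ (2 + 2 * k))" using s2 pk by simp
  then show "0 < gmres_limit \<sigma> k" using assms by (simp add: gmres_limit_def)
  have "(\<Sum>m\<le>k. (1 / \<sigma>\<^sup>2) ^ m) = (\<Sum>m<Suc k. (1 / \<sigma>\<^sup>2) ^ m)" by (simp only: lessThan_Suc_atMost)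
  also have "\<dots> = (1 - (1 / \<sigma>\<^sup>2) ^ Suc k) / (1 - 1 / \<sigma>\<^sup>2)"
    using s2 by (subst sum_gp_strict) auto
  also have "\<dots> = (1 - \<sigma> ^ (2 + 2 * k)) / ((1 - \<sigma>\<^sup>2) * \<sigma> ^ (2 * k))"
  proof -
    have "(1 / \<sigma>\<^sup>2) ^ Suc k = 1 / (\<sigma>\<^sup>2 * \<sigma> ^ (2 * k))"
      by (simp add: power_one_over power_mult)
    moreover have "\<sigma> ^ (2 + 2 * k) = \<sigma>\<^sup>2 * \<sigma> ^ (2 * k)" by (rule power_add)
    moreover have "(1 - 1 / (a * t)) / (1 - 1 / a) = (1 - a * t) / ((1 - a) * t)"
      if "0 < a" "a < 1" "0 < t" for a t :: real
      using that by (simp add: divide_simps) (simp add: algebra_simps)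
    ultimately show ?thesis using s2 assms(1) by (simp only: zero_less_power)
  qed
  finally have sum: "(\<Sum>m\<le>k. (1 / \<sigma>\<^sup>2) ^ m) = (1 - \<sigma> ^ (2 + 2 * k)) / ((1 - \<sigma>\<^sup>2) * \<sigma> ^ (2 * k))" .
  have "(gmres_limit \<sigma> k)\<^sup>2 = (1 - \<sigma>\<^sup>2) / (1 - \<sigma> ^ (2 + 2 * k)) * \<sigma> ^ (2 * k)"
    using q by (simp add: gmres_limit_def power_mult_distrib power_even_eq)
  with s2 pk assms show "(gmres_limit \<sigma> k)\<^sup>2 * (\<Sum>m\<le>k. (1 / \<sigma>\<^sup>2) ^ m) = 1"
    unfolding sum by simp
qed

text \<open>The deterministic half of the theorem. Coefficients admissible in the shifted problem
  have square sum at least the squared limit, by Cauchy-Schwarz; the equality case attains it; both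
  facts survive the Gram error.\<close>

lemma gmres_ratio_near:
  assumes G: "G \<in> carrier_mat N N" and b: "b \<in> carrier_vec N" and \<sigma>: "0 < \<sigma>" "\<sigma> < 1"
    and nz: "vec_norm2 b \<noteq> 0"
    and gram: "\<And>m l. m \<le> k \<Longrightarrow> l \<le> k \<Longrightarrow>
      cmod (krylov_gram N (($$) G) (\<lambda>v. b $ v / of_real (vec_norm2 b)) m l - of_bool (m = l)) \<le> \<eta>"
  shows "\<bar>gmres_residual_norm k (1\<^sub>m N + complex_of_real \<sigma> \<cdot>\<^sub>m G) b / vec_norm2 b - gmres_limit \<sigma> k\<bar>
    \<le> real (Suc k) * \<eta> / gmres_limit \<sigma> k"
proof -
  let ?T = "\<lambda>m. apply_mat N (($$) G) ^^ m" and ?n = "vec_norm2 b" and ?L = "gmres_limit \<sigma> k"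
  let ?f = "\<lambda>v. b $ v / of_real ?n" and ?z = "complex_of_real (- 1 / \<sigma>)"
  let ?S = "\<Sum>m\<le>k. (1 / \<sigma>\<^sup>2) ^ m" and ?\<epsilon> = "real (Suc k) * \<eta>"
  define r where "r = gmres_residual_norm k (1\<^sub>m N + complex_of_real \<sigma> \<cdot>\<^sub>m G) b / ?n"
  let ?F = "\<lambda>c. vnorm N (\<lambda>v. \<Sum>m\<le>k. c m * ?T m ?f v)"
  have n: "0 < ?n" using nz by (simp add: vec_norm2_def less_le L2_set_nonneg)
  have L: "?L\<^sup>2 * ?S = 1" "0 < ?L" by (rule gmres_limit_square[OF \<sigma>])+
  have S0: "0 < ?S" using \<sigma> by (intro sum_pos) auto
  have \<eta>: "0 \<le> \<eta>" using order_trans[OF norm_ge_zero gram[of 0 0]] by simp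
  have scale: "?T m ?f v = ?T m (($) b) v / of_real ?n" for m v
    by (induction m arbitrary: v) (simp_all add: apply_mat_def sum_divide_distrib)
  have F: "vnorm N (\<lambda>v. \<Sum>m\<le>k. c m * ?T m (($) b) v) / ?n = ?F c" for c
  proof -
    have "?F c = vnorm N (\<lambda>v. (\<Sum>m\<le>k. c m * ?T m (($) b) v) / of_real ?n)"
      unfolding scale by (simp add: sum_divide_distrib)
    also have "\<dots> = vnorm N (\<lambda>v. \<Sum>m\<le>k. c m * ?T m (($) b) v) / ?n"
      using n by (simp add: divide_inverse norm_mult norm_inverse L2_set_left_distrib)
    finally show ?thesis by simp
  qed
  have norm_z: "(\<Sum>m\<le>k. (cmod (?z ^ m))\<^sup>2) = ?S"
    using \<sigma>(1)
    by (intro sum.cong refl) (simp add: norm_power norm_divide power_divide power_mult[symmetric] mult.commute)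
  obtain c where c1: "(\<Sum>m\<le>k. c m * ?z ^ m) = 1"
    and "gmres_residual_norm k (1\<^sub>m N + complex_of_real \<sigma> \<cdot>\<^sub>m G) b = vnorm N (\<lambda>v. \<Sum>m\<le>k. c m * ?T m (($) b) v)"
    using gmres_shifted_attained[OF G b \<sigma>(1), of k] by blast
  then have c2: "r = ?F c"
    unfolding r_def by (simp only: F)
  note c = c1 c2
  have r0: "0 \<le> r" unfolding c(2) by (rule L2_set_nonneg)
  have "1 \<le> (\<Sum>m\<le>k. cmod (c m) * cmod (?z ^ m))"
    using norm_sum[of "\<lambda>m. c m * ?z ^ m" "{..k}"] unfolding c(1) by (simp add: norm_mult)
  then have "1 \<le> (\<Sum>m\<le>k. cmod (c m) * cmod (?z ^ m))\<^sup>2"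
    by (rule one_le_power)
  also have "\<dots> \<le> (\<Sum>m\<le>k. (cmod (c m))\<^sup>2) * ?S"
    unfolding norm_z[symmetric] by (rule Cauchy_Schwarz_ineq_sum)
  finally have "?L\<^sup>2 \<le> ?L\<^sup>2 * ((\<Sum>m\<le>k. (cmod (c m))\<^sup>2) * ?S)"
    using mult_left_mono[of 1 _ "?L\<^sup>2"] by simp
  then have cL: "?L\<^sup>2 \<le> (\<Sum>m\<le>k. (cmod (c m))\<^sup>2)"
    unfolding mult.left_commute[of "?L\<^sup>2"] L(1) by simp
  have L2_le: "?L\<^sup>2 \<le> 1"
  proof -
    have "1 \<le> ?S" using member_le_sum[of 0 "{..k}" "\<lambda>m. (1 / \<sigma>\<^sup>2) ^ m"] by simp
    then have "?L\<^sup>2 * 1 \<le> ?L\<^sup>2 * ?S" by (intro mult_left_mono) auto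
    with L(1) show ?thesis by simp
  qed
  have near: "\<bar>(?F e)\<^sup>2 - (\<Sum>m\<le>k. (cmod (e m))\<^sup>2)\<bar> \<le> ?\<epsilon> * (\<Sum>m\<le>k. (cmod (e m))\<^sup>2)" for e
    by (rule vnorm_krylov_combination_near[OF gram])
  have lower: "?L\<^sup>2 - ?\<epsilon> \<le> r\<^sup>2"
  \<comment> \<open>For \<open>?\<epsilon> > 1\<close> the factor \<open>1 - ?\<epsilon>\<close> is
    negative and would reverse the estimate, but then the claim is trivial since the squared limit
    is at most one.\<close>
  proof (cases "?\<epsilon> \<le> 1")
    case True
    have "(1 - ?\<epsilon>) * ?L\<^sup>2 \<le> (1 - ?\<epsilon>) * (\<Sum>m\<le>k. (cmod (c m))\<^sup>2)"
      using cL True by (intro mult_left_mono) auto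
    also have "\<dots> \<le> r\<^sup>2"
      using near[of c] unfolding c(2) left_diff_distrib mult_1_left by linarith
    finally have "?L\<^sup>2 - ?\<epsilon> * ?L\<^sup>2 \<le> r\<^sup>2" unfolding left_diff_distrib mult_1_left .
    moreover have "?\<epsilon> * ?L\<^sup>2 \<le> ?\<epsilon>" using L2_le \<eta> by (intro mult_left_le) auto
    ultimately show ?thesis by linarith
  next
    case False
    with L2_le have "?L\<^sup>2 - ?\<epsilon> \<le> 0" by simp
    also have "0 \<le> r\<^sup>2" by simp
    finally show ?thesis .
  qed
  have upper: "r\<^sup>2 \<le> ?L\<^sup>2 + ?\<epsilon>"
  proof -
    \<comment> \<open>The equality case of Cauchy-Schwarz: coefficients proportional to the powers
      of the real number \<open>?z\<close>, scaled to satisfy the constraint.\<close>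
    define d where "d = (\<lambda>m. ?z ^ m / of_real ?S)"
    have zz: "?z ^ m * ?z ^ m = complex_of_real ((1 / \<sigma>\<^sup>2) ^ m)" for m
    proof -
      have "?z * ?z = complex_of_real (1 / \<sigma>\<^sup>2)" by (simp add: power2_eq_square)
      then show ?thesis by (simp only: power_mult_distrib[symmetric] of_real_power)
    qed
    have "(\<Sum>m\<le>k. d m * ?z ^ m) = (\<Sum>m\<le>k. complex_of_real ((1 / \<sigma>\<^sup>2) ^ m)) / of_real ?S"
      by (simp only: d_def times_divide_eq_left zz sum_divide_distrib)
    also have "\<dots> = complex_of_real (?S / ?S)" by (simp only: of_real_divide of_real_sum)
    also have "?S / ?S = 1" using less_imp_neq[OF S0] by (intro divide_self) (rule not_sym)
    also have "complex_of_real 1 = 1" by (rule of_real_1)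
    finally have "(\<Sum>m\<le>k. d m * ?z ^ m) = 1" .
    then have "r \<le> ?F d"
      unfolding r_def F[symmetric] using n by (intro divide_right_mono gmres_shifted_le[OF G b \<sigma>(1)]) auto
    then have rF: "r\<^sup>2 \<le> (?F d)\<^sup>2" using r0 by (intro power_mono)
    have "(\<Sum>m\<le>k. (cmod (d m))\<^sup>2) = (\<Sum>m\<le>k. (cmod (?z ^ m))\<^sup>2) / ?S\<^sup>2"
      using S0 by (simp only: d_def norm_divide power_divide norm_of_real sum_divide_distrib power2_abs)
    also have "\<dots> = ?L\<^sup>2"
    proof -
      have "?L\<^sup>2 = 1 / ?S" by (rule eq_divide_imp[OF not_sym[OF less_imp_neq[OF S0]] L(1)])
      with S0 show ?thesis unfolding norm_z by (simp add: power2_eq_square)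
    qed
    finally have d2: "(\<Sum>m\<le>k. (cmod (d m))\<^sup>2) = ?L\<^sup>2" .
    have "(?F d)\<^sup>2 \<le> ?L\<^sup>2 + ?\<epsilon> * ?L\<^sup>2"
      using near[of d] unfolding d2 by linarith
    moreover have "?\<epsilon> * ?L\<^sup>2 \<le> ?\<epsilon>" using L2_le \<eta> by (intro mult_left_le) auto
    ultimately show ?thesis using rF by linarith
  qed
  \<comment> \<open>Since \<open>r + ?L\<close> is at least \<open>?L\<close>, the bound on the
    squares passes to \<open>r\<close> itself; this is the origin of the divisor
    \<open>gmres_limit \<sigma> k\<close>.\<close>
  have "\<bar>r - ?L\<bar> * ?L \<le> \<bar>r - ?L\<bar> * (r + ?L)"
    using r0 by (intro mult_left_mono) auto
  also have "\<dots> = \<bar>r\<^sup>2 - ?L\<^sup>2\<bar>"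
    using r0 L(2) by (simp add: power2_eq_square square_diff_square_factored abs_mult mult.commute)
  also have "\<dots> \<le> ?\<epsilon>" using lower upper by (simp add: abs_le_iff)
  finally show ?thesis using L(2) unfolding r_def by (simp add: field_simps)
qed

section \<open>The second moment of the Krylov Gram matrix\<close>

text \<open>Shared by the matrix entries and the vector coordinates, so that a term of the expansion
  is a product of one monomial of each kind.\<close>

definition mixed_monomial :: "('e \<Rightarrow> 'a \<Rightarrow> complex) \<Rightarrow> 'e multiset \<Rightarrow> 'e multiset \<Rightarrow> 'a \<Rightarrow> complex" where
  "mixed_monomial h A B \<omega> = (\<Prod>e\<in>#A. h e \<omega>) * cnj (\<Prod>e\<in>#B. h e \<omega>)"

lemma borel_measurable_prod_mset:
  fixes h :: "'e \<Rightarrow> 'a \<Rightarrow> complex"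
  shows "(\<And>e. e \<in># A \<Longrightarrow> h e \<in> borel_measurable M) \<Longrightarrow> (\<lambda>\<omega>. \<Prod>e\<in>#A. h e \<omega>) \<in> borel_measurable M"
  by (induction A) (auto intro!: borel_measurable_times)

lemma borel_measurable_mixed_monomial:
  assumes "\<And>e. e \<in># A + B \<Longrightarrow> h e \<in> borel_measurable M"
  shows "mixed_monomial h A B \<in> borel_measurable M"
  unfolding mixed_monomial_def[abs_def] using assms
  by (intro borel_measurable_times borel_measurable_cnj borel_measurable_prod_mset) auto

lemma norm_prod_mset_le_1:
  fixes h :: "'e \<Rightarrow> complex"
  shows "(\<And>e. e \<in># A \<Longrightarrow> norm (h e) \<le> 1) \<Longrightarrow> norm (\<Prod>e\<in>#A. h e) \<le> 1"
  by (induction A) (auto simp: norm_mult intro!: mult_le_one)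

lemma norm_mixed_monomial_le_1:
  assumes "\<And>e. e \<in># A + B \<Longrightarrow> norm (h e \<omega>) \<le> 1"
  shows "norm (mixed_monomial h A B \<omega>) \<le> 1"
  unfolding mixed_monomial_def norm_mult complex_mod_cnj using assms
  by (intro mult_le_one norm_prod_mset_le_1) auto

lemma prod_mset_eq_prod_count:
  assumes "finite I" "set_mset A \<subseteq> I"
  shows "(\<Prod>e\<in>#A. h e) = (\<Prod>e\<in>I. h e ^ count A e)"
  unfolding image_prod_mset_multiplicity using assms
  by (intro prod.mono_neutral_left) (auto simp: not_in_iff)

context prob_space
begin

text \<open>Passing to functions of \<open>U\<close> and \<open>V\<close> only shrinks the generated
  sigma-algebras. With a common value type on both sides, the library notion
  \<open>indep_var\<close> becomes applicable.\<close>

lemma indep_rvs_compose: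
  assumes ind: "indep_rvs S U T V"
    and \<phi>: "\<phi> \<in> measurable S P" and \<psi>: "\<psi> \<in> measurable T Q"
  shows "indep_var P (\<lambda>\<omega>. \<phi> (U \<omega>)) Q (\<lambda>\<omega>. \<psi> (V \<omega>))"
proof -
  have U: "random_variable S U" and V: "random_variable T V"
    and set: "indep_set (sets (vimage_algebra (space M) U S)) (sets (vimage_algebra (space M) V T))"
    using ind by (auto simp: indep_rvs_def)
  have sub: "sigma_sets (space M) {(\<lambda>\<omega>. h (W \<omega>)) -` A \<inter> space M |A. A \<in> sets R}
      \<subseteq> sets (vimage_algebra (space M) W K)"
    if h: "h \<in> measurable K R" and W: "random_variable K W" for h W K R
  proof -
    have "(\<lambda>\<omega>. h (W \<omega>)) -` A \<inter> space M \<in> sets (vimage_algebra (space M) W K)" if "A \<in> sets R" for A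
    proof -
      have "(\<lambda>\<omega>. h (W \<omega>)) -` A \<inter> space M = W -` (h -` A \<inter> space K) \<inter> space M"
        using measurable_space[OF W] by auto
      also have "\<dots> \<in> sets (vimage_algebra (space M) W K)"
        using measurable_sets[OF h that] by (rule in_vimage_algebra)
      finally show ?thesis .
    qed
    then have "sigma_sets (space (vimage_algebra (space M) W K)) {(\<lambda>\<omega>. h (W \<omega>)) -` A \<inter> space M |A. A \<in> sets R}
      \<subseteq> sets (vimage_algebra (space M) W K)"
      by (intro sets.sigma_sets_subset) auto
    then show ?thesis by simp
  qed
  have "indep_set (sigma_sets (space M) {(\<lambda>\<omega>. \<phi> (U \<omega>)) -` A \<inter> space M |A. A \<in> sets P})
      (sigma_sets (space M) {(\<lambda>\<omega>. \<psi> (V \<omega>)) -` A \<inter> space M |A. A \<in> sets Q})"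
    using set unfolding indep_set_def
    by (rule indep_sets_mono_sets) (use sub[OF \<phi> U] sub[OF \<psi> V] in \<open>auto split: bool.split\<close>)
  then show ?thesis
    unfolding indep_var_eq using measurable_compose[OF U \<phi>] measurable_compose[OF V \<psi>] by simp
qed

lemma expectation_norm_le:
  fixes h :: "'a \<Rightarrow> complex"
  assumes h: "integrable M h" and le: "\<And>\<omega>. \<omega> \<in> space M \<Longrightarrow> norm (h \<omega>) \<le> c"
  shows "norm (expectation h) \<le> c"
proof -
  have "norm (expectation h) \<le> expectation (\<lambda>\<omega>. norm (h \<omega>))" by (rule integral_norm_bound)
  also have "\<dots> \<le> c" using le by (intro integral_le_const integrable_norm h) auto
  finally show ?thesis .
qed

text \<open>The expectation factors over the entries, and a single entry with different
  multiplicities in \<open>A\<close> and \<open>B\<close> makes it vanish.\<close>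

lemma indep_mixed_moment:
  fixes g :: "nat \<times> nat \<Rightarrow> 'a \<Rightarrow> complex" and N :: nat
  assumes ind: "indep_vars (\<lambda>_. borel) g I" and I: "finite I"
    and int: "\<And>e a b. e \<in> I \<Longrightarrow> integrable M (\<lambda>\<omega>. g e \<omega> ^ a * cnj (g e \<omega>) ^ b)"
    and mom: "\<And>e a b. e \<in> I \<Longrightarrow> expectation (\<lambda>\<omega>. g e \<omega> ^ a * cnj (g e \<omega>) ^ b)
      = (if a = b then of_real (fact a / real N ^ a) else 0)"
    and AB: "set_mset A \<subseteq> I" "set_mset B \<subseteq> I"
  shows "integrable M (mixed_monomial g A B)"
    and "expectation (mixed_monomial g A B) = (if A = B then of_real (edge_moment A / real N ^ size A) else 0)"
proof -
  let ?h = "\<lambda>e \<omega>. g e \<omega> ^ count A e * cnj (g e \<omega>) ^ count B e"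
  have eq: "mixed_monomial g A B = (\<lambda>\<omega>. \<Prod>e\<in>I. ?h e \<omega>)"
    using AB I by (simp add: mixed_monomial_def fun_eq_iff prod_mset_eq_prod_count prod.distrib cnj_prod)
  have "indep_vars (\<lambda>_. borel) (\<lambda>e \<omega>. (\<lambda>z. z ^ count A e * cnj z ^ count B e) (g e \<omega>)) I"
    by (rule indep_vars_compose2[OF ind])
      (intro borel_measurable_times borel_measurable_power borel_measurable_cnj measurable_ident_sets, simp_all)
  then have ind': "indep_vars (\<lambda>_. borel) ?h I" .
  show "integrable M (mixed_monomial g A B)"
    unfolding eq by (rule indep_vars_integrable[OF I ind' int])
  have "expectation (mixed_monomial g A B) = (\<Prod>e\<in>I. expectation (?h e))"
    unfolding eq by (rule indep_vars_lebesgue_integral[OF I ind' int])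
  also have "\<dots> = (\<Prod>e\<in>I. if count A e = count B e then of_real (fact (count A e) / real N ^ count A e) else 0)"
    by (intro prod.cong refl mom)
  also have "\<dots> = (if A = B then of_real (edge_moment A / real N ^ size A) else 0)"
  proof (cases "A = B")
    case True
    have "(\<Prod>e\<in>I. fact (count A e) / real N ^ count A e) = (\<Prod>e\<in>set_mset A. fact (count A e) / real N ^ count A e)"
      using AB I by (intro prod.mono_neutral_right) (auto simp: not_in_iff)
    also have "\<dots> = edge_moment A / real N ^ size A"
      by (simp add: edge_moment_def prod_dividef power_sum[symmetric] size_multiset_overloaded_eq)
    finally show ?thesis using True by (simp only: simp_thms if_True of_real_prod[symmetric])
  next
    case False
    then obtain e where e: "count A e \<noteq> count B e" by (auto simp: multiset_eq_iff)
    then have "e \<in># A \<or> e \<in># B" by (metis count_eq_zero_iff)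
    then have "e \<in> I" using AB by auto
    with I e have "(\<Prod>e\<in>I. if count A e = count B e then complex_of_real (fact (count A e) / real N ^ count A e) else 0) = 0"
      by (intro prod_zero) auto
    with False show ?thesis by simp
  qed
  finally show "expectation (mixed_monomial g A B) = (if A = B then of_real (edge_moment A / real N ^ size A) else 0)" .
qed

text \<open>The upper bound on \<open>E |F|^2\<close> uses \<open>f_le\<close> pointwise, the lower
  bound on the first moment uses \<open>f_eq\<close>. The two are separate because the normalized
  vector may vanish on a null set.\<close>

lemma krylov_gram_second_moment:
  fixes g :: "nat \<times> nat \<Rightarrow> 'a \<Rightarrow> complex" and f :: "nat \<Rightarrow> 'a \<Rightarrow> complex" and N i j :: nat
  assumes N: "0 < N"
    and int_g: "\<And>A B. set_mset (A + B) \<subseteq> {..<N} \<times> {..<N} \<Longrightarrow> integrable M (mixed_monomial g A B)"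
    and mom_g: "\<And>A B. set_mset (A + B) \<subseteq> {..<N} \<times> {..<N} \<Longrightarrow>
      expectation (mixed_monomial g A B) = (if A = B then of_real (edge_moment A / real N ^ size A) else 0)"
    and f: "\<And>v. v < N \<Longrightarrow> random_variable borel (f v)"
    and f_le: "\<And>\<omega>. \<omega> \<in> space M \<Longrightarrow> (\<Sum>v<N. (cmod (f v \<omega>))\<^sup>2) \<le> 1"
    and f_eq: "AE \<omega> in M. (\<Sum>v<N. (cmod (f v \<omega>))\<^sup>2) = 1"
    and ind: "\<And>A B C D. set_mset (A + B) \<subseteq> {..<N} \<times> {..<N} \<Longrightarrow> set_mset (C + D) \<subseteq> {..<N} \<Longrightarrow>
      indep_var borel (mixed_monomial g A B) borel (mixed_monomial f C D)"
  defines "\<Delta> \<equiv> \<lambda>\<omega>. (cmod (krylov_gram N (\<lambda>e. g e \<omega>) (\<lambda>v. f v \<omega>) i j - of_bool (i = j)))\<^sup>2"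
  shows "integrable M \<Delta>"
    and "expectation \<Delta> \<le> fact (i + j) * (real i + real j + 2)\<^sup>2 / real N"
proof -
  let ?W = "walk_pairs N i j"
  define F where "F \<omega> = krylov_gram N (\<lambda>e. g e \<omega>) (\<lambda>v. f v \<omega>) i j" for \<omega>
  let ?g2 = "\<lambda>(P, Q). mixed_monomial g (edges i P) (edges j Q)"
  let ?f2 = "\<lambda>(P, Q). mixed_monomial f {#P i#} {#Q j#}"
  \<comment> \<open>In the product of an entry with its conjugate, \<open>P\<close> and
    \<open>Q'\<close> occur plainly while \<open>Q\<close> and \<open>P'\<close> occur conjugated;
    this fixes which edge multisets have to agree.\<close>
  let ?g4 = "\<lambda>(P, Q) (P', Q'). mixed_monomial g (edges i P + edges j Q') (edges j Q + edges i P')"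
  let ?f4 = "\<lambda>(P, Q) (P', Q'). mixed_monomial f {#P i, Q' j#} {#Q j, P' i#}"
  have F_sum: "F \<omega> = (\<Sum>x\<in>?W. ?g2 x \<omega> * ?f2 x \<omega>)" for \<omega>
    unfolding F_def krylov_gram_walks
    by (intro sum.cong refl) (simp add: mixed_monomial_def walk_weight_edges case_prod_unfold)
  have FF_sum: "F \<omega> * cnj (F \<omega>) = (\<Sum>x\<in>?W. \<Sum>y\<in>?W. ?g4 x y \<omega> * ?f4 x y \<omega>)" for \<omega>
    unfolding F_sum cnj_sum sum_product
    by (intro sum.cong refl) (simp add: mixed_monomial_def case_prod_unfold mult_ac)
  have f_le1: "cmod (f v \<omega>) \<le> 1" if "v < N" "\<omega> \<in> space M" for v \<omega>
  proof -
    have "(cmod (f v \<omega>))\<^sup>2 \<le> (\<Sum>v<N. (cmod (f v \<omega>))\<^sup>2)"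
      using that by (intro member_le_sum) auto
    also have "\<dots> \<le> 1\<^sup>2" using f_le that by simp
    finally show ?thesis by (rule power2_le_imp_le) simp
  qed
  \<comment> \<open>Coordinates of a vector in the unit ball are bounded by one, so its monomials
    are integrable whatever its law.\<close>
  have int_f: "integrable M (mixed_monomial f C D)" if "set_mset (C + D) \<subseteq> {..<N}" for C D
  proof (rule integrable_const_bound[where B = 1])
    show "AE \<omega> in M. norm (mixed_monomial f C D \<omega>) \<le> 1"
      using that f_le1 by (intro AE_I2 norm_mixed_monomial_le_1) auto
    show "random_variable borel (mixed_monomial f C D)"
      using that f by (intro borel_measurable_mixed_monomial) auto
  qed
  have split: "integrable M (\<lambda>\<omega>. mixed_monomial g A B \<omega> * mixed_monomial f C D \<omega>) \<and>
      expectation (\<lambda>\<omega>. mixed_monomial g A B \<omega> * mixed_monomial f C D \<omega>)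
      = (if A = B then of_real (edge_moment A / real N ^ size A) else 0) * expectation (mixed_monomial f C D)"
    if AB: "set_mset (A + B) \<subseteq> {..<N} \<times> {..<N}" and CD: "set_mset (C + D) \<subseteq> {..<N}" for A B C D
    using indep_var_integrable[OF ind[OF AB CD] int_g[OF AB] int_f[OF CD]]
      indep_var_lebesgue_integral[OF ind[OF AB CD] int_g[OF AB] int_f[OF CD]] mom_g[OF AB] by simp
  have W: "P \<in> walks N i" "Q \<in> walks N j" if "(P, Q) \<in> ?W" for P Q
    using that by (auto simp: walk_pairs_def)
  have range2: "set_mset (edges i P + edges j Q) \<subseteq> {..<N} \<times> {..<N}" "set_mset ({#P i#} + {#Q j#}) \<subseteq> {..<N}"
    if "(P, Q) \<in> ?W" for P Q
    using W[OF that] edges_subset[of P N i] edges_subset[of Q N j] walks_less[of P N i i] walks_less[of Q N j j]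
    by auto
  have range4: "set_mset ((edges i P + edges j Q') + (edges j Q + edges i P')) \<subseteq> {..<N} \<times> {..<N}"
      "set_mset ({#P i, Q' j#} + {#Q j, P' i#}) \<subseteq> {..<N}"
    if "(P, Q) \<in> ?W" "(P', Q') \<in> ?W" for P Q P' Q'
    using range2[OF that(1)] range2[OF that(2)] by auto
  have split2: "integrable M (\<lambda>\<omega>. ?g2 x \<omega> * ?f2 x \<omega>)"
      "expectation (\<lambda>\<omega>. ?g2 x \<omega> * ?f2 x \<omega>) = (case x of (P, Q) \<Rightarrow>
        if edges i P = edges j Q then of_real (edge_moment (edges i P) / real N ^ i) else 0) * expectation (?f2 x)"
    if "x \<in> ?W" for x
  proof -
    obtain P Q where x: "x = (P, Q)" by (cases x)
    with that have "(P, Q) \<in> ?W" by simp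
    note s = split[OF range2[OF this]]
    from s show "integrable M (\<lambda>\<omega>. ?g2 x \<omega> * ?f2 x \<omega>)" by (simp only: x prod.case)
    from s show "expectation (\<lambda>\<omega>. ?g2 x \<omega> * ?f2 x \<omega>) = (case x of (P, Q) \<Rightarrow>
        if edges i P = edges j Q then of_real (edge_moment (edges i P) / real N ^ i) else 0) * expectation (?f2 x)"
      by (simp only: x prod.case size_edges)
  qed
  have split4: "integrable M (\<lambda>\<omega>. ?g4 x y \<omega> * ?f4 x y \<omega>)"
      "expectation (\<lambda>\<omega>. ?g4 x y \<omega> * ?f4 x y \<omega>) = expectation (\<lambda>\<omega>. quartic_term N i j (\<lambda>v. f v \<omega>) x y)"
      "integrable M (\<lambda>\<omega>. quartic_term N i j (\<lambda>v. f v \<omega>) x y)"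
    if xy: "x \<in> ?W" "y \<in> ?W" for x y
  proof -
    obtain P Q P' Q' where x: "x = (P, Q)" and y: "y = (P', Q')" by (metis surj_pair)
    let ?c = "if edges i P + edges j Q' = edges j Q + edges i P'
      then complex_of_real (edge_moment (edges i P + edges j Q') / real N ^ (i + j)) else 0"
    have r: "(P, Q) \<in> ?W" "(P', Q') \<in> ?W" using xy x y by auto
    have q: "quartic_term N i j (\<lambda>v. f v \<omega>) x y = ?c * mixed_monomial f {#P i, Q' j#} {#Q j, P' i#} \<omega>" for \<omega>
      by (simp add: quartic_term_def x y mixed_monomial_def mult_ac)
    note s = split[OF range4[OF r]]
    from s show "integrable M (\<lambda>\<omega>. ?g4 x y \<omega> * ?f4 x y \<omega>)" by (simp add: x y)
    from s show "expectation (\<lambda>\<omega>. ?g4 x y \<omega> * ?f4 x y \<omega>) = expectation (\<lambda>\<omega>. quartic_term N i j (\<lambda>v. f v \<omega>) x y)"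
      unfolding q by (simp only: x y prod.case integral_mult_right_zero size_union size_edges)
    show "integrable M (\<lambda>\<omega>. quartic_term N i j (\<lambda>v. f v \<omega>) x y)"
      unfolding q by (rule integrable_mult_right[OF int_f[OF range4(2)[OF r]]])
  qed
  have int_F: "integrable M F"
    unfolding F_sum[abs_def] using split2(1) by (rule Bochner_Integration.integrable_sum)
  have int_FF: "integrable M (\<lambda>\<omega>. F \<omega> * cnj (F \<omega>))"
    unfolding FF_sum using split4(1) by (intro Bochner_Integration.integrable_sum)
  let ?\<delta> = "of_bool (i = j) :: real" and ?C = "fact (i + j) * (real i + real j + 2)\<^sup>2 / real N"
  have "expectation (\<lambda>\<omega>. F \<omega> * cnj (F \<omega>))
      = (\<Sum>x\<in>?W. \<Sum>y\<in>?W. expectation (\<lambda>\<omega>. quartic_term N i j (\<lambda>v. f v \<omega>) x y))"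
    unfolding FF_sum by (simp add: Bochner_Integration.integral_sum split4)
  \<comment> \<open>The sum moves back under the expectation, so that the bound for fixed
    \<open>f\<close> applies at each sample point.\<close>
  also have "\<dots> = expectation (\<lambda>\<omega>. \<Sum>x\<in>?W. \<Sum>y\<in>?W. quartic_term N i j (\<lambda>v. f v \<omega>) x y)"
    by (simp add: Bochner_Integration.integral_sum split4)
  also have "norm \<dots> \<le> ?\<delta> + ?C"
    using split4(3) norm_sum_quartic_term_le[OF N f_le]
    by (intro expectation_norm_le Bochner_Integration.integrable_sum) auto
  finally have FF: "Re (expectation (\<lambda>\<omega>. F \<omega> * cnj (F \<omega>))) \<le> ?\<delta> + ?C"
    using complex_Re_le_cmod order_trans by blast
  \<comment> \<open>The factor \<open>?\<delta>\<close> makes the claim trivial off the diagonal,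
    where the first moment drops out of the expansion of \<open>\<Delta>\<close>.\<close>
  have F: "?\<delta> \<le> ?\<delta> * Re (expectation F)"
  proof (cases "i = j")
    case True
    let ?c = "\<lambda>(P, Q). if edges i P = edges j Q then complex_of_real (edge_moment (edges i P) / real N ^ i) else 0"
    let ?q = "\<lambda>\<omega>. \<Sum>x\<in>?W. ?c x * ?f2 x \<omega>"
    have int_f2: "integrable M (?f2 x)" if "x \<in> ?W" for x
      using that int_f[OF range2(2)] by (auto split: prod.splits)
    have int_q: "integrable M ?q"
      using int_f2 by (intro Bochner_Integration.integrable_sum integrable_mult_right)
    have "expectation F = (\<Sum>x\<in>?W. expectation (\<lambda>\<omega>. ?g2 x \<omega> * ?f2 x \<omega>))"
      unfolding F_sum[abs_def] by (rule Bochner_Integration.integral_sum) (rule split2(1))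
    also have "\<dots> = (\<Sum>x\<in>?W. ?c x * expectation (?f2 x))"
      by (intro sum.cong refl split2(2))
    also have "\<dots> = (\<Sum>x\<in>?W. expectation (\<lambda>\<omega>. ?c x * ?f2 x \<omega>))"
      by (simp only: integral_mult_right_zero)
    also have "\<dots> = expectation ?q"
      using int_f2 by (intro Bochner_Integration.integral_sum[symmetric] integrable_mult_right)
    finally have "Re (expectation F) = expectation (\<lambda>\<omega>. Re (?q \<omega>))"
      using int_q by (simp only: integral_Re)
    also have "\<dots> \<ge> 1"
    proof (rule integral_ge_const)
      show "integrable M (\<lambda>\<omega>. Re (?q \<omega>))" using int_q by (rule integrable_Re)
      show "AE \<omega> in M. 1 \<le> Re (?q \<omega>)"
        using f_eq
      proof eventually_elim
        case (elim \<omega>)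
        have "?q \<omega> = (\<Sum>(P, Q)\<in>walk_pairs N i i. (if edges i P = edges i Q
            then complex_of_real (edge_moment (edges i P) / real N ^ i) else 0) * (f (P i) \<omega> * cnj (f (Q i) \<omega>)))"
          using True by (intro sum.cong) (auto simp: mixed_monomial_def)
        then show ?case using Re_sum_quadratic_term_ge[OF N, of "\<lambda>v. f v \<omega>" i] elim by (simp only:)
      qed
    qed
    finally show ?thesis using True by simp
  qed simp
  have \<Delta>: "\<Delta> \<omega> = Re (F \<omega> * cnj (F \<omega>)) - 2 * ?\<delta> * Re (F \<omega>) + ?\<delta>" for \<omega>
    unfolding \<Delta>_def F_def[symmetric] cmod_power2 by (cases "i = j") (simp_all add: power2_eq_square algebra_simps)
  show "integrable M \<Delta>"
    unfolding \<Delta>[abs_def] using int_F int_FF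
    by (intro Bochner_Integration.integrable_add Bochner_Integration.integrable_diff integrable_mult_right
        integrable_Re integrable_const)
  have "expectation \<Delta> = Re (expectation (\<lambda>\<omega>. F \<omega> * cnj (F \<omega>))) - 2 * ?\<delta> * Re (expectation F) + ?\<delta>"
    unfolding \<Delta>[abs_def]
    by (simp only: Bochner_Integration.integral_add Bochner_Integration.integral_diff integral_mult_right_zero
        Bochner_Integration.integrable_diff integrable_mult_right integrable_Re integrable_const
        int_F int_FF integral_Re) (simp add: prob_space)
  also have "\<dots> \<le> ?C" using FF F by simp
  finally show "expectation \<Delta> \<le> ?C" .
qed

end

section \<open>Independence and moments of the Ginibre entries\<close>

context prob_space
begin

lemma indep_vars_complex_entries:
  fixes X Y :: "nat \<Rightarrow> nat \<Rightarrow> 'a \<Rightarrow> real"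
  assumes ind: "indep_vars (\<lambda>_. borel) (case_sum (\<lambda>(i, j). X i j) (\<lambda>(i, j). Y i j)) UNIV"
  shows "indep_vars (\<lambda>_. borel) (\<lambda>e \<omega>. Complex (X (fst e) (snd e) \<omega>) (Y (fst e) (snd e) \<omega>)) I"
    and "indep_var borel (X i j) borel (Y i j)"
proof -
  let ?XY = "case_sum (\<lambda>(i, j). X i j) (\<lambda>(i, j). Y i j)"
  \<comment> \<open>Real and imaginary part of one entry form a block; disjoint blocks of an
    independent family are independent.\<close>
  let ?K = "\<lambda>e :: nat \<times> nat. {Inl e, Inr e}"
  have "indep_vars (\<lambda>e. PiM (?K e) (\<lambda>_. borel)) (\<lambda>e \<omega>. restrict (\<lambda>i. ?XY i \<omega>) (?K e)) I"
    by (rule indep_vars_restrict[OF ind]) (auto simp: disjoint_family_on_def)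
  then have "indep_vars (\<lambda>_. borel) (\<lambda>e \<omega>. (\<lambda>h. complex_of_real (h (Inl e)) + \<i> * complex_of_real (h (Inr e)))
      (restrict (\<lambda>i. ?XY i \<omega>) (?K e))) I"
    by (rule indep_vars_compose2) measurable
  then show "indep_vars (\<lambda>_. borel) (\<lambda>e \<omega>. Complex (X (fst e) (snd e) \<omega>) (Y (fst e) (snd e) \<omega>)) I"
    by (simp add: case_prod_unfold Complex_eq)
  let ?A = "{Inl (i, j)} :: (nat \<times> nat + nat \<times> nat) set" and ?B = "{Inr (i, j)} :: (nat \<times> nat + nat \<times> nat) set"
  have "indep_var (PiM ?A (\<lambda>_. borel)) (\<lambda>\<omega>. restrict (\<lambda>i. ?XY i \<omega>) ?A)
      (PiM ?B (\<lambda>_. borel)) (\<lambda>\<omega>. restrict (\<lambda>i. ?XY i \<omega>) ?B)"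
    by (rule indep_var_restrict[OF ind]) auto
  then have "indep_var borel ((\<lambda>h. h (Inl (i, j))) \<circ> (\<lambda>\<omega>. restrict (\<lambda>i. ?XY i \<omega>) ?A))
      borel ((\<lambda>h. h (Inr (i, j))) \<circ> (\<lambda>\<omega>. restrict (\<lambda>i. ?XY i \<omega>) ?B))"
    by (rule indep_var_compose) measurable
  then show "indep_var borel (X i j) borel (Y i j)"
    by (simp add: comp_def)
qed

lemma ginibre_entry:
  assumes "i < N" "j < N"
  shows "ginibre X Y N \<omega> $$ (i, j) = Complex (X i j \<omega>) (Y i j \<omega>) / of_real (sqrt (2 * real N))"
  using assms by (simp add: ginibre_def Complex_eq field_simps)

text \<open>The moment \<open>2 ^ a * fact a\<close> of the unnormalized entry is divided by the
  \<open>a\<close>-th power of \<open>2 * N\<close>, so an entry has mean square modulus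
  \<open>1 / N\<close>.\<close>

lemma ginibre_entry_moment:
  fixes X Y :: "nat \<Rightarrow> nat \<Rightarrow> 'a \<Rightarrow> real"
  assumes ind: "indep_vars (\<lambda>_. borel) (case_sum (\<lambda>(i, j). X i j) (\<lambda>(i, j). Y i j)) UNIV"
    and X: "\<And>i j. distributed M lborel (X i j) std_normal_density"
    and Y: "\<And>i j. distributed M lborel (Y i j) std_normal_density"
    and N: "0 < N" and e: "e \<in> {..<N} \<times> {..<N}"
  defines "g \<equiv> \<lambda>\<omega>. ginibre X Y N \<omega> $$ e"
  shows "integrable M (\<lambda>\<omega>. g \<omega> ^ a * cnj (g \<omega>) ^ b)"
    and "expectation (\<lambda>\<omega>. g \<omega> ^ a * cnj (g \<omega>) ^ b) = (if a = b then of_real (fact a / real N ^ a) else 0)"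
proof -
  obtain i j where ij: "e = (i, j)" "i < N" "j < N" using e by auto
  let ?Z = "\<lambda>\<omega>. Complex (X i j \<omega>) (Y i j \<omega>)" and ?s = "complex_of_real (sqrt (2 * real N))"
  have g: "g \<omega> ^ a * cnj (g \<omega>) ^ b = (?Z \<omega> ^ a * cnj (?Z \<omega>) ^ b) / ?s ^ (a + b)" for \<omega>
    by (simp add: g_def ij ginibre_entry power_divide power_add)
  note Z = complex_gaussian_moment[OF X Y indep_vars_complex_entries(2)[OF ind], of i j a b]
  show "integrable M (\<lambda>\<omega>. g \<omega> ^ a * cnj (g \<omega>) ^ b)"
    unfolding g using Z(1) by simp
  have s: "?s ^ (a + a) = of_real (2 ^ a * real N ^ a)" for a
    by (simp only: of_real_power[symmetric] mult_2[symmetric] power_mult real_sqrt_pow2 of_nat_0_le_iff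
      zero_le_mult_iff zero_le_numeral simp_thms power_mult_distrib)
  show "expectation (\<lambda>\<omega>. g \<omega> ^ a * cnj (g \<omega>) ^ b) = (if a = b then of_real (fact a / real N ^ a) else 0)"
    unfolding g using Z(2) by (simp add: s)
qed

end

section \<open>Measurability and convergence\<close>

lemma borel_mat_entry:
  assumes "e \<in> {..<N} \<times> {..<N}"
  shows "(\<lambda>A. A $$ e) \<in> borel_measurable (borel_mat N)"
proof -
  let ?V = "{..<N} \<times> {..<N}"
  have "(\<lambda>A. (\<lambda>ij\<in>?V. A $$ ij) e) \<in> borel_measurable (borel_mat N)"
    unfolding borel_mat_def
    by (rule measurable_compose[OF measurable_vimage_algebra1 measurable_component_singleton[OF assms]])
      (simp only: space_PiM, intro Pi_I iffD2[OF restrict_PiE_iff] ballI, simp)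
  then show ?thesis using assms by simp
qed

lemma borel_vec_entry:
  assumes "v < N"
  shows "(\<lambda>b. b $ v) \<in> borel_measurable (borel_vec N)"
proof -
  have "(\<lambda>b. (\<lambda>i\<in>{..<N}. b $ i) v) \<in> borel_measurable (borel_vec N)"
    unfolding borel_vec_def
    by (rule measurable_compose[OF measurable_vimage_algebra1 measurable_component_singleton])
      (simp only: space_PiM, intro Pi_I iffD2[OF restrict_PiE_iff] ballI, use assms in simp_all)
  then show ?thesis using assms by simp
qed

lemma space_borel_mat: "space (borel_mat N) = carrier_mat N N"
  by (simp add: borel_mat_def)

lemma space_borel_vec: "space (borel_vec N) = carrier_vec N"
  by (simp add: borel_vec_def)

lemma borel_vec_norm2: "vec_norm2 \<in> borel_measurable (borel_vec N)"
proof -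
  have "(\<lambda>b. sqrt (\<Sum>v<N. (cmod (b $ v))\<^sup>2)) \<in> borel_measurable (borel_vec N)"
    by (intro measurable_compose[OF _ borel_measurable_sqrt] borel_measurable_sum borel_measurable_power
        measurable_compose[OF _ borel_measurable_norm] borel_vec_entry) auto
  also have "?this \<longleftrightarrow> vec_norm2 \<in> borel_measurable (borel_vec N)"
    by (rule measurable_cong) (simp add: space_borel_vec vec_norm2_def L2_set_def)
  finally show ?thesis .
qed

lemma borel_measurable_apply_mat_power:
  assumes "\<And>e. e \<in> {..<N} \<times> {..<N} \<Longrightarrow> (\<lambda>\<omega>. g \<omega> e) \<in> borel_measurable M"
    and "\<And>v. v < N \<Longrightarrow> (\<lambda>\<omega>. f \<omega> v) \<in> borel_measurable M" and "v < N"
  shows "(\<lambda>\<omega>. (apply_mat N (g \<omega>) ^^ m) (f \<omega>) v) \<in> borel_measurable M"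
  using assms(3)
proof (induction m arbitrary: v)
  case (Suc m)
  show ?case
    unfolding funpow.simps comp_def apply_mat_def[of _ _ _ v]
    by (intro borel_measurable_sum borel_measurable_times Suc.IH assms(1)) (use Suc.prems in auto)
qed (simp add: assms(2))

lemma borel_measurable_gmres_residual_norm:
  assumes A: "A \<in> measurable M (borel_mat N)" and b: "b \<in> measurable M (borel_vec N)"
  shows "(\<lambda>\<omega>. gmres_residual_norm k (A \<omega>) (b \<omega>)) \<in> borel_measurable M"
proof -
  have "(\<lambda>\<omega>. lsq_dist N k (($) (b \<omega>)) (\<lambda>m. (apply_mat N (($$) (A \<omega>)) ^^ Suc m) (($) (b \<omega>)))) \<in> borel_measurable M"
    by (intro borel_measurable_lsq_dist borel_measurable_apply_mat_power
        measurable_compose[OF A borel_mat_entry] measurable_compose[OF b borel_vec_entry])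
  moreover have "gmres_residual_norm k (A \<omega>) (b \<omega>)
      = lsq_dist N k (($) (b \<omega>)) (\<lambda>m. (apply_mat N (($$) (A \<omega>)) ^^ Suc m) (($) (b \<omega>)))" if "\<omega> \<in> space M" for \<omega>
    using measurable_space[OF A that] measurable_space[OF b that]
    by (intro gmres_residual_norm_eq_lsq_dist) (simp_all only: space_borel_mat space_borel_vec)
  ultimately show ?thesis by (simp cong: measurable_cong)
qed

lemma measurable_borel_matI:
  assumes "\<And>\<omega>. \<omega> \<in> space M \<Longrightarrow> A \<omega> \<in> carrier_mat N N"
    and "\<And>e. e \<in> {..<N} \<times> {..<N} \<Longrightarrow> (\<lambda>\<omega>. A \<omega> $$ e) \<in> borel_measurable M"
  shows "A \<in> measurable M (borel_mat N)"
  unfolding borel_mat_def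
proof (rule measurable_vimage_algebra2)
  show "(\<lambda>\<omega>. \<lambda>ij\<in>{..<N} \<times> {..<N}. A \<omega> $$ ij) \<in> measurable M (PiM ({..<N} \<times> {..<N}) (\<lambda>_. borel))"
    using assms(2) by (rule measurable_restrict)
qed (use assms(1) in auto)

text \<open>Division by zero sends the zero vector to itself, so the normalized vector lies in the
  unit ball at every sample point and has norm one almost surely.\<close>

lemma sum_normalized_square:
  assumes "b \<in> carrier_vec N"
  shows "(\<Sum>v<N. (cmod (b $ v / of_real (vec_norm2 b)))\<^sup>2) = of_bool (vec_norm2 b \<noteq> 0)"
proof -
  have sq: "(\<Sum>v<N. (cmod (b $ v))\<^sup>2) = (vec_norm2 b)\<^sup>2"
    using assms by (simp add: vec_norm2_def L2_set_def sum_nonneg)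
  have "(\<Sum>v<N. (cmod (b $ v / of_real (vec_norm2 b)))\<^sup>2) = (\<Sum>v<N. (cmod (b $ v))\<^sup>2) / (vec_norm2 b)\<^sup>2"
    by (simp add: norm_divide power_divide sum_divide_distrib)
  then show ?thesis unfolding sq by simp
qed

lemma vec_norm2_eq_0:
  assumes "b \<in> carrier_vec N" "vec_norm2 b = 0"
  shows "b = 0\<^sub>v N"
  using assms by (intro eq_vecI) (auto simp: vec_norm2_def L2_set_eq_0_iff)

theorem theorem3p1:
  fixes M :: "'a measure"
    and X Y :: "nat \<Rightarrow> nat \<Rightarrow> 'a \<Rightarrow> real"
    and b :: "nat \<Rightarrow> 'a \<Rightarrow> complex vec"
    and \<sigma> :: real and k :: nat
  assumes "prob_space M"
    and "prob_space.indep_vars M (\<lambda>_. borel)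
           (case_sum (\<lambda>(i, j). X i j) (\<lambda>(i, j). Y i j)) UNIV"
    and "\<And>i j. distributed M lborel (X i j) std_normal_density"
    and "\<And>i j. distributed M lborel (Y i j) std_normal_density"
    and "0 < \<sigma>" and "\<sigma> < 1"
    and "\<And>N. prob_space.indep_rvs M (borel_mat N) (ginibre X Y N) (borel_vec N) (b N)"
    and "\<And>N. 0 < N \<Longrightarrow> AE \<omega> in M. b N \<omega> \<noteq> 0\<^sub>v N"
  shows "prob_space.tendsto_in_prob M
           (\<lambda>N \<omega>. gmres_residual_norm k
                    (1\<^sub>m N + complex_of_real \<sigma> \<cdot>\<^sub>m ginibre X Y N \<omega>) (b N \<omega>)
                  / vec_norm2 (b N \<omega>))
           (sqrt ((1 - \<sigma>\<^sup>2) / (1 - \<sigma> ^ (2 + 2 * k))) * \<sigma> ^ k)"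
proof -
  interpret prob_space M by (rule assms(1))
  let ?G = "ginibre X Y" and ?L = "gmres_limit \<sigma> k"
  define Z where "Z N \<omega> = gmres_residual_norm k (1\<^sub>m N + complex_of_real \<sigma> \<cdot>\<^sub>m ?G N \<omega>) (b N \<omega>)
    / vec_norm2 (b N \<omega>)" for N \<omega>
  have G: "random_variable (borel_mat N) (?G N)" and b: "random_variable (borel_vec N) (b N)" for N
    using assms(7)[of N] by (auto simp: indep_rvs_def)
  have Gc: "?G N \<omega> \<in> carrier_mat N N" for N \<omega>
    by (auto simp: ginibre_def)
  have bc: "b N \<omega> \<in> carrier_vec N" if "\<omega> \<in> space M" for N \<omega>
    using measurable_space[OF b that] by (simp only: space_borel_vec)
  have A: "random_variable (borel_mat N) (\<lambda>\<omega>. 1\<^sub>m N + complex_of_real \<sigma> \<cdot>\<^sub>m ?G N \<omega>)" for N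
  proof (rule measurable_borel_matI)
    fix e assume e: "e \<in> {..<N} \<times> {..<N}"
    have "(\<lambda>\<omega>. 1\<^sub>m N $$ e + complex_of_real \<sigma> * ?G N \<omega> $$ e) \<in> borel_measurable M"
      using measurable_compose[OF G borel_mat_entry[OF e]]
      by (intro borel_measurable_add borel_measurable_times borel_measurable_const)
    moreover have "(1\<^sub>m N + complex_of_real \<sigma> \<cdot>\<^sub>m ?G N \<omega>) $$ e = 1\<^sub>m N $$ e + complex_of_real \<sigma> * ?G N \<omega> $$ e" for \<omega>
      using e Gc[of N \<omega>] by auto
    ultimately show "(\<lambda>\<omega>. (1\<^sub>m N + complex_of_real \<sigma> \<cdot>\<^sub>m ?G N \<omega>) $$ e) \<in> borel_measurable M"
      by (simp only:)
  qed (use Gc in auto)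
  have nb: "random_variable borel (\<lambda>\<omega>. vec_norm2 (b N \<omega>))" for N
    by (rule measurable_compose[OF b borel_vec_norm2])
  have Z: "random_variable borel (Z N)" for N
    unfolding Z_def[abs_def] by (intro borel_measurable_divide borel_measurable_gmres_residual_norm[OF A b] nb)

  define f where "f N v \<omega> = b N \<omega> $ v / complex_of_real (vec_norm2 (b N \<omega>))" for N v \<omega>
  define D where "D N i j \<omega> = cmod (krylov_gram N (($$) (?G N \<omega>)) (\<lambda>v. f N v \<omega>) i j - of_bool (i = j))" for N i j \<omega>
  define C where "C i j = fact (i + j) * (real i + real j + 2)\<^sup>2" for i j :: nat
  have moment: "integrable M (\<lambda>\<omega>. (D N i j \<omega>)\<^sup>2)" "expectation (\<lambda>\<omega>. (D N i j \<omega>)\<^sup>2) \<le> C i j / real N"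
    if N: "0 < N" for N i j
  proof -
    let ?V = "{..<N} \<times> {..<N}" and ?g = "\<lambda>e \<omega>. ?G N \<omega> $$ e"
    have ind_g: "indep_vars (\<lambda>_. borel) ?g ?V"
    proof -
      have "indep_vars (\<lambda>_. borel) (\<lambda>e \<omega>. (\<lambda>z. z / complex_of_real (sqrt (2 * real N)))
          (Complex (X (fst e) (snd e) \<omega>) (Y (fst e) (snd e) \<omega>))) ?V"
        by (rule indep_vars_compose2[OF indep_vars_complex_entries(1)[OF assms(2)]]) measurable
      then show ?thesis
        by (subst indep_vars_cong[OF refl _ refl]) (auto simp: fun_eq_iff ginibre_entry)
    qed
    note entry = ginibre_entry_moment[OF assms(2-4) N]
    have g: "integrable M (mixed_monomial ?g A B)"
        "expectation (mixed_monomial ?g A B) = (if A = B then of_real (edge_moment A / real N ^ size A) else 0)"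
      if "set_mset (A + B) \<subseteq> ?V" for A B
      using indep_mixed_moment[OF ind_g _ entry, of A B] that by auto
    have f_meas: "(\<lambda>c. c $ v / complex_of_real (vec_norm2 c)) \<in> borel_measurable (borel_vec N)" if "v < N" for v
      by (intro borel_measurable_divide borel_vec_entry that measurable_compose[OF borel_vec_norm2])
        (rule borel_measurable_continuous_onI, intro continuous_intros)
    have f: "random_variable borel (f N v)" if "v < N" for v
      unfolding f_def[abs_def] by (rule measurable_compose[OF b f_meas[OF that]])
    have sum_f: "(\<Sum>v<N. (cmod (f N v \<omega>))\<^sup>2) = of_bool (vec_norm2 (b N \<omega>) \<noteq> 0)" if "\<omega> \<in> space M" for \<omega>
      unfolding f_def by (rule sum_normalized_square[OF bc[OF that]])
    have f_le: "(\<Sum>v<N. (cmod (f N v \<omega>))\<^sup>2) \<le> 1" if "\<omega> \<in> space M" for \<omega>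
      using sum_f[OF that] by simp
    have f_eq: "AE \<omega> in M. (\<Sum>v<N. (cmod (f N v \<omega>))\<^sup>2) = 1"
      using assms(8)[OF N] AE_space
    proof eventually_elim
      case (elim \<omega>)
      then show ?case using sum_f[of \<omega>] vec_norm2_eq_0[OF bc] by auto
    qed
    have ind: "indep_var borel (mixed_monomial ?g A B) borel (mixed_monomial (f N) C D)"
      if "set_mset (A + B) \<subseteq> ?V" "set_mset (C + D) \<subseteq> {..<N}" for A B C D
    proof -
      \<comment> \<open>Normalization is a measurable function of \<open>b\<close> alone, so both
        monomials inherit independence from the whole matrix and the whole vector.\<close>
      have "mixed_monomial (\<lambda>e A. A $$ e) A B \<in> borel_measurable (borel_mat N)"
        using that by (intro borel_measurable_mixed_monomial borel_mat_entry) auto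
      moreover have "mixed_monomial (\<lambda>v c. c $ v / complex_of_real (vec_norm2 c)) C D \<in> borel_measurable (borel_vec N)"
        using that by (intro borel_measurable_mixed_monomial f_meas) auto
      ultimately show ?thesis
        using indep_rvs_compose[OF assms(7)[of N]] unfolding mixed_monomial_def f_def by blast
    qed
    note second_moment = krylov_gram_second_moment[of N ?g "f N" i j, OF N g f f_le f_eq ind]
    show "integrable M (\<lambda>\<omega>. (D N i j \<omega>)\<^sup>2)" unfolding D_def by (rule second_moment)
    show "expectation (\<lambda>\<omega>. (D N i j \<omega>)\<^sup>2) \<le> C i j / real N"
      unfolding D_def C_def by (rule second_moment)
  qed

  have "(\<lambda>N. prob {\<omega> \<in> space M. \<bar>Z N \<omega> - ?L\<bar> > \<epsilon>}) \<longlonglongrightarrow> 0" if \<epsilon>: "0 < \<epsilon>" for \<epsilon>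
  proof -
    have L: "0 < ?L" by (rule gmres_limit_square(2)[OF assms(5,6)])
    \<comment> \<open>Chosen so that the error bound of \<open>gmres_ratio_near\<close> is exactly
      \<open>\<epsilon>\<close>.\<close>
    define \<eta> where "\<eta> = \<epsilon> * ?L / real (Suc k)"
    have \<eta>: "0 < \<eta>" using \<epsilon> L by (simp add: \<eta>_def)
    \<comment> \<open>Stated with squares, to which Markov's inequality and the second moment apply
      directly.\<close>
    let ?B = "\<lambda>N i j. {\<omega> \<in> space M. \<eta>\<^sup>2 \<le> (D N i j \<omega>)\<^sup>2}"
    have bound: "prob {\<omega> \<in> space M. \<bar>Z N \<omega> - ?L\<bar> > \<epsilon>} \<le> (\<Sum>i\<le>k. \<Sum>j\<le>k. C i j / \<eta>\<^sup>2) / real N" if N: "0 < N" for N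
    proof -
      have meas: "?B N i j \<in> events" for i j
        using moment(1)[OF N, of i j] by measurable
      have "AE \<omega> in M. \<omega> \<in> {\<omega> \<in> space M. \<bar>Z N \<omega> - ?L\<bar> > \<epsilon>} \<longrightarrow> \<omega> \<in> (\<Union>i\<in>{..k}. \<Union>j\<in>{..k}. ?B N i j)"
        using assms(8)[OF N] AE_space
      proof eventually_elim
        case (elim \<omega>)
        have nz: "vec_norm2 (b N \<omega>) \<noteq> 0" using elim vec_norm2_eq_0[OF bc] by auto
        show ?case
        proof (rule impI, rule ccontr)
          assume far: "\<omega> \<in> {\<omega> \<in> space M. \<bar>Z N \<omega> - ?L\<bar> > \<epsilon>}"
            and "\<omega> \<notin> (\<Union>i\<in>{..k}. \<Union>j\<in>{..k}. ?B N i j)"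
          then have small: "(D N i j \<omega>)\<^sup>2 < \<eta>\<^sup>2" if "i \<le> k" "j \<le> k" for i j
            using that elim by (auto simp: not_le)
          have le: "D N i j \<omega> \<le> \<eta>" if "i \<le> k" "j \<le> k" for i j
            by (rule less_imp_le[OF power2_less_imp_less[OF small[OF that] less_imp_le[OF \<eta>]]])
          have "\<bar>Z N \<omega> - ?L\<bar> \<le> real (Suc k) * \<eta> / ?L"
            unfolding Z_def
            by (rule gmres_ratio_near[OF Gc bc[OF elim(2)] assms(5,6) nz le[unfolded D_def f_def]])
          also have "\<dots> = \<epsilon>" using L by (simp add: \<eta>_def)
          finally show False using far by simp
        qed
      qed
      then have "prob {\<omega> \<in> space M. \<bar>Z N \<omega> - ?L\<bar> > \<epsilon>} \<le> prob (\<Union>i\<in>{..k}. \<Union>j\<in>{..k}. ?B N i j)"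
        by (rule finite_measure_mono_AE) (use meas in auto)
      also have "\<dots> \<le> (\<Sum>i\<le>k. prob (\<Union>j\<in>{..k}. ?B N i j))"
        by (rule finite_measure_subadditive_finite) (use meas in auto)
      also have "\<dots> \<le> (\<Sum>i\<le>k. \<Sum>j\<le>k. prob (?B N i j))"
        by (intro sum_mono finite_measure_subadditive_finite) (use meas in auto)
      also have "\<dots> \<le> (\<Sum>i\<le>k. \<Sum>j\<le>k. C i j / \<eta>\<^sup>2 / real N)"
      proof (intro sum_mono)
        fix i j
        have "prob (?B N i j) \<le> expectation (\<lambda>\<omega>. (D N i j \<omega>)\<^sup>2) / \<eta>\<^sup>2"
          using \<eta> meas moment(1)[OF N] by (intro integral_Markov_inequality_measure[where A = "space M"]) auto
        also have "\<dots> \<le> C i j / real N / \<eta>\<^sup>2"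
          using moment(2)[OF N] by (intro divide_right_mono) auto
        finally show "prob (?B N i j) \<le> C i j / \<eta>\<^sup>2 / real N" by (simp add: mult.commute)
      qed
      finally show ?thesis by (simp only: sum_divide_distrib)
    qed
    show ?thesis
    proof (rule tendsto_sandwich[OF _ _ tendsto_const])
      show "\<forall>\<^sub>F N in sequentially. prob {\<omega> \<in> space M. \<bar>Z N \<omega> - ?L\<bar> > \<epsilon>} \<le> (\<Sum>i\<le>k. \<Sum>j\<le>k. C i j / \<eta>\<^sup>2) / real N"
        \<comment> \<open>The bound is needed only eventually; \<open>N = 0\<close>, where
          \<open>b\<close> can only be the zero vector, is left out.\<close>
        using eventually_gt_at_top[of 0] by eventually_elim (rule bound)
      show "(\<lambda>N. (\<Sum>i\<le>k. \<Sum>j\<le>k. C i j / \<eta>\<^sup>2) / real N) \<longlonglongrightarrow> 0"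
        by (rule lim_const_over_n)
    qed (simp add: measure_nonneg)
  qed
  with Z show ?thesis
    unfolding tendsto_in_prob_def Z_def[abs_def] gmres_limit_def by blast
qed

end
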